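(* Let $n\geq 2$, $d\geq 3$, $S=\mathbb{C}[x_0,\ldots,x_n]$, let $0\neq f\in S_d$, and let $X=V(f)\subseteq\mathbb{P}^n$ have at most isolated singularities. Assume that $X$ is not a cone and that $H_0=V(x_0)\in U_f$, i.e. $X\cap V(x_0)$ is a smooth hypersurface in $V(x_0)\simeq\mathbb{P}^{n-1}$. Let $R=\mathbb{C}[x_1,\ldots,x_n]$ and consider the linear map $$\psi(f,x_0):\mathbb{C}^n\to R_d/(J_{\overline f})_d,\qquad (b_1,\ldots,b_n)\mapsto\left[(b_1x_1+\cdots+b_nx_n)\overline{f}_0\right].$$ Then $\psi(f,x_0)$ is not injective if and only if one of the following conditions holds: (1) $\operatorname{indeg}(\operatorname{Syz}(J_f))=1$; (2) the multiplication map $x_0:M(f)_{d-1}\to M(f)_d$ is not injective.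
   Context: Notation: $f_i=\partial f/\partial x_i$, $J_f=(f_0,\ldots,f_n)\subseteq S$, and $M(f)=S/J_f$ with its standard grading. For $h\in S$, $\overline h=h(0,x_1,\ldots,x_n)\in R$; thus $\overline f_0$ is the restriction of $f_0=\partial f/\partial x_0$ to $x_0=0$. $J_{\overline f}\subseteq R$ is the Jacobian ideal of $\overline f\in R_d$, generated by $\partial\overline f/\partial x_i=\overline{f}_i$, $1\le i\le n$. $\operatorname{Syz}(J_f)=\{(a_0,\ldots,a_n)\in S^{n+1}\mid\sum_i a_if_i=0\}$, graded by the degree of the coefficients $a_i$. For a graded module $N$, $\operatorname{indeg}(N)$ is the smallest degree $k$ with $N_k\neq0$; so condition (1) says that there is a nontrivial relation $\sum L_if_i=0$ with linear forms $L_i$ but none with constants (the latter being automatic for non-cones). $X$ is a cone if, after a linear change of coordinates, $f$ does not depend on all the variables. *)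

theory Defs
  imports
    "HOL-Library.Poly_Mapping"
    "HOL-Library.Extended_Nat"
    "HOL-Algebra.QuotRing"
    "Jordan_Normal_Form.Matrix"
begin

section \<open>Complex polynomials in variables indexed by natural numbers\<close>

text \<open>A monomial is a finitely supported exponent vector. A polynomial ring in finitely many
  variables is cut out of this type by a set \<open>I\<close> of admissible indices:
  \<open>{0..n}\<close> gives \<open>S\<close> and \<open>{1..n}\<close> gives \<open>R\<close>.\<close>

type_synonym mon = "nat \<Rightarrow>\<^sub>0 nat"
type_synonym cpoly = "mon \<Rightarrow>\<^sub>0 complex"

definition Const :: "complex \<Rightarrow> cpoly" where
  "Const c = Poly_Mapping.single 0 c"

definition Var :: "nat \<Rightarrow> cpoly" where
  "Var i = Poly_Mapping.single (Poly_Mapping.single i 1) 1"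

definition vars :: "cpoly \<Rightarrow> nat set" where
  "vars p = (\<Union>m\<in>Poly_Mapping.keys p. Poly_Mapping.keys m)"

definition mon_degree :: "mon \<Rightarrow> nat" where
  "mon_degree m = (\<Sum>i\<in>Poly_Mapping.keys m. Poly_Mapping.lookup m i)"

definition partial :: "nat \<Rightarrow> cpoly \<Rightarrow> cpoly" where
  "partial i p = (\<Sum>m\<in>Poly_Mapping.keys p.
     Poly_Mapping.single (m - Poly_Mapping.single i 1)
       (of_nat (Poly_Mapping.lookup m i) * Poly_Mapping.lookup p m))"

definition poly_eval :: "cpoly \<Rightarrow> (nat \<Rightarrow> complex) \<Rightarrow> complex" where
  "poly_eval p a = (\<Sum>m\<in>Poly_Mapping.keys p.
     Poly_Mapping.lookup p m * (\<Prod>i\<in>Poly_Mapping.keys m. a i ^ Poly_Mapping.lookup m i))"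

definition poly_subst :: "(nat \<Rightarrow> cpoly) \<Rightarrow> cpoly \<Rightarrow> cpoly" where
  "poly_subst \<sigma> p = (\<Sum>m\<in>Poly_Mapping.keys p.
     Const (Poly_Mapping.lookup p m) * (\<Prod>i\<in>Poly_Mapping.keys m. \<sigma> i ^ Poly_Mapping.lookup m i))"

text \<open>The restriction \<open>h(0, x\<^sub>1, \<dots>, x\<^sub>n)\<close> to the hyperplane \<open>x\<^sub>0 = 0\<close>.\<close>

definition restrict0 :: "cpoly \<Rightarrow> cpoly" where
  "restrict0 h = poly_subst (\<lambda>i. if i = 0 then 0 else Var i) h"

definition poly_ring :: "nat set \<Rightarrow> cpoly ring" where
  "poly_ring I = \<lparr>carrier = {p. vars p \<subseteq> I}, monoid.mult = (*), one = 1, zero = 0, add = (+)\<rparr>"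

lemma vars_add: "vars (p + q) \<subseteq> vars p \<union> vars q"
  unfolding vars_def using Poly_Mapping.keys_add[of p q] by blast

lemma vars_mult: "vars (p * q) \<subseteq> vars p \<union> vars q"
proof -
  have "Poly_Mapping.keys m \<subseteq> vars p \<union> vars q" if m: "m \<in> Poly_Mapping.keys (p * q)" for m
  proof -
    obtain a b where ab: "m = a + b" "a \<in> Poly_Mapping.keys p" "b \<in> Poly_Mapping.keys q"
      using m Poly_Mapping.keys_mult[of p q] by blast
    show ?thesis unfolding vars_def ab(1) using Poly_Mapping.keys_add[of a b] ab by blast
  qed
  then show ?thesis unfolding vars_def[of "p * q"] by blast
qed

lemma vars_uminus: "vars (- p) = vars p"
  by (simp add: vars_def)

lemma cring_poly_ring: "cring (poly_ring I)"
proof (rule cringI)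
  show "abelian_group (poly_ring I)"
  proof (rule abelian_groupI)
    fix x assume "x \<in> carrier (poly_ring I)"
    then show "\<exists>y\<in>carrier (poly_ring I). y \<oplus>\<^bsub>poly_ring I\<^esub> x = \<zero>\<^bsub>poly_ring I\<^esub>"
      by (intro bexI[of _ "- x"]) (simp_all add: poly_ring_def vars_uminus)
  next
    fix x y assume "x \<in> carrier (poly_ring I)" "y \<in> carrier (poly_ring I)"
    then show "x \<oplus>\<^bsub>poly_ring I\<^esub> y \<in> carrier (poly_ring I)"
      using vars_add[of x y] by (auto simp: poly_ring_def)
  qed (auto simp: poly_ring_def vars_def ac_simps)
next
  show "comm_monoid (poly_ring I)"
  proof (rule comm_monoidI)
    fix x y assume "x \<in> carrier (poly_ring I)" "y \<in> carrier (poly_ring I)"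
    then show "x \<otimes>\<^bsub>poly_ring I\<^esub> y \<in> carrier (poly_ring I)"
      using vars_mult[of x y] by (auto simp: poly_ring_def)
  qed (auto simp: poly_ring_def vars_def ac_simps)
qed (auto simp: poly_ring_def algebra_simps)

text \<open>The space of forms of degree \<open>k\<close>; as a homogeneous component it contains \<open>0\<close>.\<close>

definition forms :: "nat set \<Rightarrow> nat \<Rightarrow> cpoly set" where
  "forms I k = {p \<in> carrier (poly_ring I). \<forall>m\<in>Poly_Mapping.keys p. mon_degree m = k}"


section \<open>Jacobian ideal, Milnor algebra and syzygies\<close>

definition jac_ideal :: "nat set \<Rightarrow> cpoly \<Rightarrow> cpoly set" where
  "jac_ideal I g = Idl\<^bsub>poly_ring I\<^esub> ((\<lambda>i. partial i g) ` I)"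

definition milnor_algebra :: "nat set \<Rightarrow> cpoly \<Rightarrow> cpoly set ring" where
  "milnor_algebra I g = poly_ring I Quot jac_ideal I g"

definition milnor_component :: "nat set \<Rightarrow> cpoly \<Rightarrow> nat \<Rightarrow> cpoly set set" where
  "milnor_component I g k = (\<lambda>h. jac_ideal I g +>\<^bsub>poly_ring I\<^esub> h) ` forms I k"

definition milnor_mult :: "nat set \<Rightarrow> cpoly \<Rightarrow> cpoly \<Rightarrow> cpoly set \<Rightarrow> cpoly set" where
  "milnor_mult I g q c = (jac_ideal I g +>\<^bsub>poly_ring I\<^esub> q) \<otimes>\<^bsub>milnor_algebra I g\<^esub> c"

definition syz :: "nat set \<Rightarrow> cpoly \<Rightarrow> (nat \<Rightarrow> cpoly) set" where
  "syz I g = {a \<in> I \<rightarrow>\<^sub>E carrier (poly_ring I). (\<Sum>i\<in>I. a i * partial i g) = 0}"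

definition syz_component :: "nat set \<Rightarrow> cpoly \<Rightarrow> nat \<Rightarrow> (nat \<Rightarrow> cpoly) set" where
  "syz_component I g k = {a \<in> syz I g. \<forall>i\<in>I. a i \<in> forms I k}"

text \<open>Initial degree of a graded module with zero element \<open>z\<close> and homogeneous components
  \<open>N k\<close>; the zero module has initial degree \<open>\<infinity>\<close>.\<close>

definition indeg :: "'a \<Rightarrow> (nat \<Rightarrow> 'a set) \<Rightarrow> enat" where
  "indeg z N = (INF k\<in>{k. N k \<noteq> {z}}. enat k)"

definition indeg_syz :: "nat set \<Rightarrow> cpoly \<Rightarrow> enat" where
  "indeg_syz I g = indeg (\<lambda>i\<in>I. 0) (syz_component I g)"


section \<open>Projective hypersurfaces\<close>

text \<open>Points of the projective space with homogeneous coordinates indexed by \<open>I\<close> are the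
  classes of nonzero coordinate vectors up to nonzero scalars.\<close>

definition proj_point :: "nat set \<Rightarrow> (nat \<Rightarrow> complex) \<Rightarrow> (nat \<Rightarrow> complex) set" where
  "proj_point I a = {\<lambda>i\<in>I. c * a i | c. c \<noteq> 0}"

definition proj_space :: "nat set \<Rightarrow> (nat \<Rightarrow> complex) set set" where
  "proj_space I = proj_point I ` {a \<in> I \<rightarrow>\<^sub>E UNIV. \<exists>i\<in>I. a i \<noteq> 0}"

definition vanishes_at :: "cpoly \<Rightarrow> (nat \<Rightarrow> complex) set \<Rightarrow> bool" where
  "vanishes_at g P \<longleftrightarrow> (\<forall>a\<in>P. poly_eval g a = 0)"

definition sing_locus :: "nat set \<Rightarrow> cpoly \<Rightarrow> (nat \<Rightarrow> complex) set set" where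
  "sing_locus I g = {P \<in> proj_space I. vanishes_at g P \<and> (\<forall>i\<in>I. vanishes_at (partial i g) P)}"

definition smooth_hypersurface :: "nat set \<Rightarrow> cpoly \<Rightarrow> bool" where
  "smooth_hypersurface I g \<longleftrightarrow> g \<noteq> 0 \<and> sing_locus I g = {}"

text \<open>Every singular point is isolated in the singular locus for the Zariski topology, whose
  basic open sets are the nonvanishing loci of forms. By noetherianity this says that the
  singular locus is finite.\<close>

definition isolated_singularities :: "nat set \<Rightarrow> cpoly \<Rightarrow> bool" where
  "isolated_singularities I g \<longleftrightarrow>
     (\<forall>P\<in>sing_locus I g. \<exists>k. \<exists>h\<in>forms I k. {Q \<in> sing_locus I g. \<not> vanishes_at h Q} = {P})"

definition linear_change :: "nat \<Rightarrow> complex mat \<Rightarrow> cpoly \<Rightarrow> cpoly" where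
  "linear_change n A g = poly_subst (\<lambda>i. \<Sum>j\<le>n. Const (A $$ (i, j)) * Var j) g"

definition is_cone :: "nat \<Rightarrow> cpoly \<Rightarrow> bool" where
  "is_cone n g \<longleftrightarrow> (\<exists>A\<in>carrier_mat (n + 1) (n + 1). invertible_mat A \<and>
     (\<exists>j\<le>n. j \<notin> vars (linear_change n A g)))"


section \<open>The map \<open>\<psi>(f, x\<^sub>0)\<close>\<close>

text \<open>The value is the coset in \<open>R\<^sub>d / (J\<^sub>g)\<^sub>d\<close> for \<open>g\<close> the restriction of \<open>f\<close>. Vectors are
  indexed from \<open>0\<close>, so \<open>b\<^sub>i\<close> is the entry with index \<open>i - 1\<close>.\<close>

definition psi :: "nat \<Rightarrow> nat \<Rightarrow> cpoly \<Rightarrow> complex vec \<Rightarrow> cpoly set" where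
  "psi n d f b = (jac_ideal {1..n} (restrict0 f) \<inter> forms {1..n} d) +>\<^bsub>poly_ring {1..n}\<^esub>
     ((\<Sum>i=1..n. Const (b $ (i - 1)) * Var i) * restrict0 (partial 0 f))"

end

theory Submission
  imports Defs "Jordan_Normal_Form.Spectral_Radius"
begin

text \<open>Lifting a relation \<open>l f\<^sub>0 = \<Sum> q\<^sub>i f\<^sub>i\<close> from the hyperplane to \<open>S\<close>,
  and conversely restricting a linear relation \<open>\<Sum> L\<^sub>i f\<^sub>i = x\<^sub>0 h\<close> to it, reduces the
  equivalence to two facts. The partial derivatives of a non-cone are linearly independent. The partial
  derivatives of a smooth form \<open>g\<close> of degree \<open>d \<ge> 3\<close> satisfy no relation
  \<open>\<Sum> (A x)\<^sub>i g\<^sub>i = 0\<close> with \<open>A \<noteq> 0\<close>. For the second, differentiating the relation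
  gives \<open>H(x) A x = - A\<^sup>T \<nabla>g(x)\<close> with \<open>H\<close> the Hessian. At an eigenvector for \<open>\<lambda>\<close> Euler's identity
  turns this into an eigenvector \<open>\<nabla>g\<close> of \<open>A\<^sup>T\<close> for \<open>-(d-1)\<lambda>\<close>; taking \<open>|\<lambda>|\<close> maximal, \<open>A\<close> is nilpotent.
  If \<open>A\<^sup>q\<^sup>+\<^sup>1 = 0 \<noteq> A\<^sup>q\<close>, then along the curve \<open>y(t) = exp(t A) v\<close> the gradient satisfies
  \<open>(\<nabla>g)' = - A\<^sup>T \<nabla>g\<close>, so it has degree at most \<open>q\<close> in \<open>t\<close>; its coefficient at \<open>t\<close> to the power
  \<open>q(d-1) > q\<close> is \<open>\<nabla>g(A\<^sup>q v / q!)\<close>, which therefore vanishes.\<close>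

section \<open>Monomials and forms\<close>

lemma cpoly_eq_sum_single:
  fixes p :: cpoly
  shows "p = (\<Sum>m\<in>Poly_Mapping.keys p. Poly_Mapping.single m (Poly_Mapping.lookup p m))"
  by (rule poly_mapping_eqI)
     (auto simp: lookup_sum lookup_single when_def in_keys_iff sum.delta)

text \<open>Reduces additive identities to monomials. The zero polynomial needs no case of its own,
  since it is the monomial with coefficient 0.\<close>

lemma cpoly_single_induct [case_names single add]:
  fixes p :: cpoly
  assumes "\<And>m c. P (Poly_Mapping.single m c)"
    and "\<And>p q. P p \<Longrightarrow> P q \<Longrightarrow> P (p + q)"
  shows "P p"
proof -
  have "P (\<Sum>m\<in>A. Poly_Mapping.single m (Poly_Mapping.lookup p m))" if "finite A" for A
    using that
  proof (induction A rule: finite_induct)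
    case empty
    show ?case using assms(1)[of 0 0] by simp
  qed (simp add: assms)
  then show ?thesis
    by (subst cpoly_eq_sum_single) simp
qed

lemma mon_degree_superset:
  assumes "finite A" "Poly_Mapping.keys m \<subseteq> A"
  shows "mon_degree m = (\<Sum>i\<in>A. Poly_Mapping.lookup m i)"
  unfolding mon_degree_def using assms
  by (intro sum.mono_neutral_left) (auto simp: in_keys_iff)

lemma mon_degree_add: "mon_degree (a + b) = mon_degree a + mon_degree b"
proof -
  let ?A = "Poly_Mapping.keys a \<union> Poly_Mapping.keys b"
  have "Poly_Mapping.keys (a + b) \<subseteq> ?A" by (rule keys_add)
  then show ?thesis
    by (simp add: mon_degree_superset[of ?A] lookup_add sum.distrib)
qed

lemma mon_degree_zero [simp]: "mon_degree 0 = 0"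
  by (simp add: mon_degree_def)

lemma mon_degree_single [simp]: "mon_degree (Poly_Mapping.single i k) = k"
  by (simp add: mon_degree_def)

lemma mon_degree_eq_0_iff: "mon_degree m = 0 \<longleftrightarrow> m = 0"
  by (auto simp: mon_degree_def in_keys_iff intro!: poly_mapping_eqI)

lemma mon_degree_pos_obtain:
  assumes "mon_degree m > 0"
  obtains i where "Poly_Mapping.lookup m i \<noteq> 0"
  using assms mon_degree_eq_0_iff[of m] by (metis in_keys_iff keys_eq_empty equals0I less_irrefl)

lemma mon_split:
  fixes m :: mon
  assumes "Poly_Mapping.lookup m i \<noteq> 0"
  shows "m = Poly_Mapping.single i 1 + (m - Poly_Mapping.single i 1)"
  using assms
  by (intro poly_mapping_eqI) (auto simp: lookup_add lookup_minus lookup_single when_def)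

lemma keys_diff_single_subset:
  fixes m :: mon
  shows "Poly_Mapping.keys (m - Poly_Mapping.single i 1) \<subseteq> Poly_Mapping.keys m"
  by (auto simp: in_keys_iff lookup_minus)

lemma forms_iff:
  "p \<in> forms I k \<longleftrightarrow>
     (\<forall>m\<in>Poly_Mapping.keys p. Poly_Mapping.keys m \<subseteq> I \<and> mon_degree m = k)"
  by (auto simp: forms_def poly_ring_def vars_def)

lemma forms_vars: "p \<in> forms I k \<Longrightarrow> vars p \<subseteq> I"
  by (auto simp: forms_def poly_ring_def)

lemma forms_zero [simp]: "0 \<in> forms I k"
  by (simp add: forms_iff)

lemma forms_add: "p \<in> forms I k \<Longrightarrow> q \<in> forms I k \<Longrightarrow> p + q \<in> forms I k"
  using keys_add[of p q] by (auto simp: forms_iff)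

lemma forms_uminus: "p \<in> forms I k \<Longrightarrow> - p \<in> forms I k"
  by (auto simp: forms_iff)

lemma forms_diff: "p \<in> forms I k \<Longrightarrow> q \<in> forms I k \<Longrightarrow> p - q \<in> forms I k"
  using forms_add[of p I k "- q"] forms_uminus[of q] by simp

lemma forms_sum: "(\<And>x. x \<in> A \<Longrightarrow> p x \<in> forms I k) \<Longrightarrow> (\<Sum>x\<in>A. p x) \<in> forms I k"
  by (induction A rule: infinite_finite_induct) (auto intro: forms_add)

lemma forms_mult: "p \<in> forms I k \<Longrightarrow> q \<in> forms I l \<Longrightarrow> p * q \<in> forms I (k + l)"
  unfolding forms_iff
proof
  fix m assume *: "\<forall>m\<in>Poly_Mapping.keys p. Poly_Mapping.keys m \<subseteq> I \<and> mon_degree m = k"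
    "\<forall>m\<in>Poly_Mapping.keys q. Poly_Mapping.keys m \<subseteq> I \<and> mon_degree m = l"
    "m \<in> Poly_Mapping.keys (p * q)"
  then obtain a b where "m = a + b" "a \<in> Poly_Mapping.keys p" "b \<in> Poly_Mapping.keys q"
    using keys_mult[of p q] by blast
  then show "Poly_Mapping.keys m \<subseteq> I \<and> mon_degree m = k + l"
    using * keys_add[of a b] by (metis mon_degree_add Un_least subset_trans)
qed

lemma forms_mono: "I \<subseteq> J \<Longrightarrow> forms I k \<subseteq> forms J k"
  by (fastforce simp: forms_iff)

lemma Const_forms [simp]: "Const c \<in> forms I 0"
  by (simp add: forms_iff Const_def)

lemma Var_forms: "i \<in> I \<Longrightarrow> Var i \<in> forms I 1"
  by (auto simp: forms_iff Var_def)

lemma Const_add: "Const (a + b) = Const a + Const b"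
  by (simp add: Const_def single_add)

lemma Const_mult: "Const (a * b) = Const a * Const b"
  by (simp add: Const_def mult_single)

lemma Const_1 [simp]: "Const 1 = 1"
  by (simp add: Const_def)

lemma Const_0 [simp]: "Const 0 = 0"
  by (simp add: Const_def)

lemma Const_eq_0_iff [simp]: "Const c = 0 \<longleftrightarrow> c = 0"
  by (metis Const_def lookup_single_eq lookup_zero single_zero)

lemma forms_0_iff: "p \<in> forms I 0 \<longleftrightarrow> (\<exists>c. p = Const c)"
proof
  assume "p \<in> forms I 0"
  then have "Poly_Mapping.lookup p m = 0" if "m \<noteq> 0" for m
    using that mon_degree_eq_0_iff[of m] by (metis forms_iff in_keys_iff)
  then have "p = Const (Poly_Mapping.lookup p 0)"
    by (intro poly_mapping_eqI) (auto simp: Const_def lookup_single when_def)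
  then show "\<exists>c. p = Const c" ..
qed auto

lemma Const_mult_forms: "p \<in> forms I k \<Longrightarrow> Const c * p \<in> forms I k"
  using forms_mult[of "Const c" I 0 p k] by simp

text \<open>A monomial of degree 1 is a single variable, so a linear form is determined by its
  coefficients at the \<open>Poly_Mapping.single i 1\<close>.\<close>

lemma forms_1_expand:
  assumes "p \<in> forms I 1" and "finite I"
  shows "p = (\<Sum>i\<in>I. Const (Poly_Mapping.lookup p (Poly_Mapping.single i 1)) * Var i)"
proof (rule poly_mapping_eqI)
  fix m
  let ?c = "\<lambda>i. Poly_Mapping.lookup p (Poly_Mapping.single i 1)"
  have *: "Poly_Mapping.lookup (\<Sum>i\<in>I. Const (?c i) * Var i) m =
      (\<Sum>i\<in>I. if Poly_Mapping.single i 1 = m then Poly_Mapping.lookup p m else 0)"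
    by (auto simp: lookup_sum Const_def Var_def mult_single lookup_single when_def intro!: sum.cong)
  show "Poly_Mapping.lookup p m = Poly_Mapping.lookup (\<Sum>i\<in>I. Const (?c i) * Var i) m"
  proof (cases "\<exists>i\<in>I. m = Poly_Mapping.single i 1")
    case True
    then obtain i where i: "i \<in> I" "m = Poly_Mapping.single i 1" by blast
    have "Poly_Mapping.single j (1::nat) = m \<longleftrightarrow> j = i" for j
      unfolding i by (metis lookup_single_eq lookup_single_not_eq zero_neq_one)
    then show ?thesis unfolding * using i assms by (simp add: sum.delta)
  next
    case False
    have "m \<notin> Poly_Mapping.keys p"
    proof
      assume "m \<in> Poly_Mapping.keys p"
      then have m: "Poly_Mapping.keys m \<subseteq> I" "mon_degree m = 1"
        using assms by (auto simp: forms_iff)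
      then obtain i where i: "Poly_Mapping.lookup m i \<noteq> 0"
        using mon_degree_pos_obtain[of m] by auto
      have "mon_degree (m - Poly_Mapping.single i 1) = 0"
        using m(2) mon_split[OF i] mon_degree_add[of "Poly_Mapping.single i 1" "m - Poly_Mapping.single i 1"]
        by simp
      then have "m = Poly_Mapping.single i 1"
        using mon_split[OF i] by (simp add: mon_degree_eq_0_iff)
      moreover have "i \<in> I" using i m by (auto simp: in_keys_iff)
      ultimately show False using False by blast
    qed
    then show ?thesis unfolding * using False by (auto simp: in_keys_iff intro!: sum.neutral[symmetric])
  qed
qed

lemma lookup_linear_form:
  assumes "finite I" "j \<in> I"
  shows "Poly_Mapping.lookup (\<Sum>i\<in>I. Const (c i) * Var i) (Poly_Mapping.single j 1) = c j"
proof -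
  have "Poly_Mapping.single i (1::nat) = Poly_Mapping.single j 1 \<longleftrightarrow> i = j" for i
    by (metis lookup_single_eq lookup_single_not_eq zero_neq_one)
  then show ?thesis using assms
    by (simp add: lookup_sum Const_def Var_def mult_single lookup_single when_def sum.delta)
qed

lemma single_eq_Var_mult:
  assumes "Poly_Mapping.lookup m i \<noteq> 0"
  shows "Poly_Mapping.single m c = Var i * Poly_Mapping.single (m - Poly_Mapping.single i 1) c"
  by (subst mon_split[OF assms]) (simp add: Var_def mult_single)

text \<open>Monomials are built by induction on their degree, one variable at a time; all variables
  peeled off lie in \<open>I\<close>. This is the form suited to ring homomorphisms and
  derivations.\<close>

lemma cpoly_induct [consumes 1, case_names Const add Var_mult]:
  assumes "vars p \<subseteq> I"
    and Const: "\<And>c. P (Const c)"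
    and add: "\<And>p q. P p \<Longrightarrow> P q \<Longrightarrow> P (p + q)"
    and Var: "\<And>i p. i \<in> I \<Longrightarrow> P p \<Longrightarrow> P (Var i * p)"
  shows "P p"
proof -
  have single: "P (Poly_Mapping.single m c)" if "Poly_Mapping.keys m \<subseteq> I" for m c
    using that
  proof (induction "mon_degree m" arbitrary: m)
    case 0
    then show ?case using Const[of c] by (simp add: mon_degree_eq_0_iff Const_def)
  next
    case (Suc k)
    then obtain i where i: "Poly_Mapping.lookup m i \<noteq> 0"
      by (metis mon_degree_pos_obtain zero_less_Suc)
    let ?m = "m - Poly_Mapping.single i 1"
    have "k = mon_degree ?m"
      using Suc.hyps(2) mon_split[OF i] mon_degree_add[of "Poly_Mapping.single i 1" ?m] by simp
    moreover have "Poly_Mapping.keys ?m \<subseteq> I"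
      using keys_diff_single_subset Suc.prems by blast
    ultimately have "P (Poly_Mapping.single ?m c)" by (rule Suc.hyps(1))
    moreover have "i \<in> I" using i Suc.prems by (auto simp: in_keys_iff)
    ultimately show ?case by (subst single_eq_Var_mult[OF i]) (rule Var)
  qed
  have "P (\<Sum>m\<in>A. Poly_Mapping.single m (Poly_Mapping.lookup p m))"
    if "finite A" "A \<subseteq> Poly_Mapping.keys p" for A
    using that
  proof (induction A rule: finite_induct)
    case empty
    show ?case using Const[of 0] by simp
  next
    case (insert m A)
    then show ?case using assms(1) by (auto simp: vars_def intro!: add single)
  qed
  then show ?thesis
    by (subst cpoly_eq_sum_single) simp
qed

section \<open>Partial derivatives\<close>

lemma partial_superset:
  assumes "finite A" "Poly_Mapping.keys p \<subseteq> A"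
  shows "partial i p = (\<Sum>m\<in>A. Poly_Mapping.single (m - Poly_Mapping.single i 1)
     (of_nat (Poly_Mapping.lookup m i) * Poly_Mapping.lookup p m))"
  unfolding partial_def using assms
  by (intro sum.mono_neutral_left) (auto simp: in_keys_iff)

lemma partial_add: "partial i (p + q) = partial i p + partial i q"
proof -
  let ?A = "Poly_Mapping.keys p \<union> Poly_Mapping.keys q"
  have "Poly_Mapping.keys (p + q) \<subseteq> ?A" by (rule keys_add)
  then show ?thesis
    by (simp add: partial_superset[of ?A] lookup_add sum.distrib single_add distrib_left)
qed

lemma partial_single: "partial i (Poly_Mapping.single m c) =
    Poly_Mapping.single (m - Poly_Mapping.single i 1) (of_nat (Poly_Mapping.lookup m i) * c)"
  by (simp add: partial_def)

lemma partial_0 [simp]: "partial i 0 = 0"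
  by (simp add: partial_def)

lemma partial_sum: "partial i (\<Sum>x\<in>A. p x) = (\<Sum>x\<in>A. partial i (p x))"
  by (induction A rule: infinite_finite_induct) (auto simp: partial_add)

lemma partial_Const [simp]: "partial i (Const c) = 0"
  by (simp add: Const_def partial_single)

lemma partial_Var: "partial i (Var j) = (if i = j then 1 else 0)"
  by (auto simp: Var_def partial_single lookup_single_not_eq simp flip: single_one)

lemma partial_mult: "partial i (p * q) = partial i p * q + p * partial i q"
proof (induction p rule: cpoly_single_induct)
  case (single m c)
  show ?case
  proof (induction q rule: cpoly_single_induct)
    case (single m' c')
    let ?e = "Poly_Mapping.single i (1::nat)"
    \<comment> \<open>Exponents are subtracted with truncation, so the two exponent vectors may
      differ when \<open>i\<close> does not occur in \<open>m\<close>; in that case the coefficient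
      is 0.\<close>
    have 1: "Poly_Mapping.single (m + m' - ?e) (of_nat (Poly_Mapping.lookup m i) * (c * c'))
       = Poly_Mapping.single ((m - ?e) + m') (of_nat (Poly_Mapping.lookup m i) * (c * c'))"
    proof (cases "Poly_Mapping.lookup m i = 0")
      case False
      then have "m + m' - ?e = (m - ?e) + m'"
        by (intro poly_mapping_eqI) (auto simp: lookup_add lookup_minus lookup_single when_def)
      then show ?thesis by simp
    qed simp
    have 2: "Poly_Mapping.single (m + m' - ?e) (of_nat (Poly_Mapping.lookup m' i) * (c * c'))
       = Poly_Mapping.single (m + (m' - ?e)) (of_nat (Poly_Mapping.lookup m' i) * (c * c'))"
    proof (cases "Poly_Mapping.lookup m' i = 0")
      case False
      then have "m + m' - ?e = m + (m' - ?e)"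
        by (intro poly_mapping_eqI) (auto simp: lookup_add lookup_minus lookup_single when_def)
      then show ?thesis by simp
    qed simp
    show ?case using 1 2
      by (simp add: mult_single partial_single lookup_add single_add distrib_right mult.assoc
          mult.left_commute[of c])
  qed (simp add: partial_add algebra_simps)
qed (simp add: partial_add algebra_simps)

lemma partial_commute: "partial i (partial j p) = partial j (partial i p)"
proof (induction p rule: cpoly_single_induct)
  case (single m c)
  then show ?case
    by (cases "i = j")
      (simp_all add: partial_single lookup_minus lookup_single_not_eq mult_ac diff_diff_add
        add.commute)
qed (simp add: partial_add)

text \<open>For \<open>k = 0\<close> the truncated degree \<open>k - 1\<close> is again 0, which is
  correct because the derivative then vanishes.\<close>

lemma partial_forms:
  assumes "p \<in> forms I k"
  shows "partial i p \<in> forms I (k - 1)"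
  unfolding partial_def
proof (rule forms_sum)
  fix m assume m: "m \<in> Poly_Mapping.keys p"
  let ?m = "m - Poly_Mapping.single i 1"
  show "Poly_Mapping.single ?m (of_nat (Poly_Mapping.lookup m i) * Poly_Mapping.lookup p m) \<in> forms I (k - 1)"
  proof (cases "Poly_Mapping.lookup m i = 0")
    case False
    have "mon_degree m = 1 + mon_degree ?m"
      using mon_split[OF False] mon_degree_add[of "Poly_Mapping.single i 1" ?m] by simp
    then show ?thesis
      using assms m keys_diff_single_subset[of m i] by (fastforce simp: forms_iff)
  qed simp
qed

lemma partial_vars:
  assumes "vars p \<subseteq> I" shows "vars (partial i p) \<subseteq> I"
proof -
  have "Poly_Mapping.keys m' \<subseteq> I" if "m' \<in> Poly_Mapping.keys (partial i p)" for m'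
  proof -
    let ?s = "\<lambda>m. Poly_Mapping.single (m - Poly_Mapping.single i 1)
      (of_nat (Poly_Mapping.lookup m i) * Poly_Mapping.lookup p m)"
    have "(\<Sum>m\<in>Poly_Mapping.keys p. Poly_Mapping.lookup (?s m) m') \<noteq> 0"
      using that by (simp add: partial_def in_keys_iff lookup_sum)
    then obtain m where "m \<in> Poly_Mapping.keys p" "Poly_Mapping.lookup (?s m) m' \<noteq> 0"
      by (rule sum.not_neutral_contains_not_neutral)
    then have m: "m \<in> Poly_Mapping.keys p" "m' = m - Poly_Mapping.single i 1"
      by (auto simp: lookup_single when_def split: if_splits)
    then show ?thesis
      using keys_diff_single_subset[of m i] assms by (auto simp: vars_def)
  qed
  then show ?thesis by (auto simp: vars_def)
qed

text \<open>The operator \<open>Var i * partial i\<close> multiplies a monomial by its exponent at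
  \<open>i\<close>, and these exponents add up to \<open>k\<close>.\<close>

lemma euler_identity:
  assumes "p \<in> forms I k" "finite I"
  shows "(\<Sum>i\<in>I. Var i * partial i p) = of_nat k * p"
proof -
  have 1: "Var i * partial i (Poly_Mapping.single m c) =
      Poly_Mapping.single m (of_nat (Poly_Mapping.lookup m i) * c)" for i m c
  proof (cases "Poly_Mapping.lookup m i = 0")
    case False
    show ?thesis unfolding partial_single by (rule single_eq_Var_mult[OF False, symmetric])
  qed (simp add: partial_single)
  let ?s = "\<lambda>m. Poly_Mapping.single m (Poly_Mapping.lookup p m)"
  have "(\<Sum>i\<in>I. Var i * partial i p) =
      (\<Sum>i\<in>I. Var i * partial i (\<Sum>m\<in>Poly_Mapping.keys p. ?s m))"
    by (simp flip: cpoly_eq_sum_single)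
  also have "\<dots> = (\<Sum>m\<in>Poly_Mapping.keys p. \<Sum>i\<in>I. Var i * partial i (?s m))"
    by (simp add: partial_sum sum_distrib_left) (rule sum.swap)
  also have "\<dots> = (\<Sum>m\<in>Poly_Mapping.keys p. of_nat k * ?s m)"
  proof (rule sum.cong[OF refl])
    fix m assume "m \<in> Poly_Mapping.keys p"
    then have k: "k = (\<Sum>i\<in>I. Poly_Mapping.lookup m i)"
      using assms mon_degree_superset[of I m] by (auto simp: forms_iff)
    have "(\<Sum>i\<in>I. Var i * partial i (?s m)) =
        Poly_Mapping.single m (of_nat k * Poly_Mapping.lookup p m)"
      unfolding 1 k using assms(2)
      by (induction I rule: finite_induct) (auto simp: single_add distrib_right)
    also have "\<dots> = of_nat k * ?s m"
      by (simp add: mult_single flip: single_of_nat)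
    finally show "(\<Sum>i\<in>I. Var i * partial i (?s m)) = of_nat k * ?s m" .
  qed
  also have "\<dots> = of_nat k * p"
    by (simp add: sum_distrib_left[symmetric] flip: cpoly_eq_sum_single)
  finally show ?thesis .
qed

section \<open>Evaluation in a commutative algebra\<close>

text \<open>One theory of evaluation for three targets: complex numbers (values at points),
  multivariate polynomials (substitutions) and univariate polynomials (values along polynomial
  curves). The map \<open>\<phi>\<close> embeds the constants.\<close>

locale coeff_hom =
  fixes \<phi> :: "complex \<Rightarrow> 'a :: comm_ring_1"
  assumes hom_add: "\<phi> (a + b) = \<phi> a + \<phi> b"
    and hom_mult: "\<phi> (a * b) = \<phi> a * \<phi> b"
    and hom_1: "\<phi> 1 = 1"
begin

lemma hom_0: "\<phi> 0 = 0"
  using hom_add[of 0 0] by simp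

definition ev :: "(nat \<Rightarrow> 'a) \<Rightarrow> cpoly \<Rightarrow> 'a" where
  "ev y p = (\<Sum>m\<in>Poly_Mapping.keys p.
     \<phi> (Poly_Mapping.lookup p m) * (\<Prod>i\<in>Poly_Mapping.keys m. y i ^ Poly_Mapping.lookup m i))"

lemma ev_superset:
  assumes "finite A" "Poly_Mapping.keys p \<subseteq> A"
  shows "ev y p = (\<Sum>m\<in>A. \<phi> (Poly_Mapping.lookup p m) *
     (\<Prod>i\<in>Poly_Mapping.keys m. y i ^ Poly_Mapping.lookup m i))"
  unfolding ev_def using assms
  by (intro sum.mono_neutral_left) (auto simp: in_keys_iff hom_0)

lemma ev_add: "ev y (p + q) = ev y p + ev y q"
proof -
  let ?A = "Poly_Mapping.keys p \<union> Poly_Mapping.keys q"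
  have "Poly_Mapping.keys (p + q) \<subseteq> ?A" by (rule keys_add)
  then show ?thesis
    by (simp add: ev_superset[of ?A] lookup_add sum.distrib hom_add distrib_right)
qed

lemma ev_single: "ev y (Poly_Mapping.single m c) =
    \<phi> c * (\<Prod>i\<in>Poly_Mapping.keys m. y i ^ Poly_Mapping.lookup m i)"
  by (auto simp: ev_def hom_0)

lemma mon_value_add:
  "(\<Prod>i\<in>Poly_Mapping.keys (a + b). y i ^ Poly_Mapping.lookup (a + b) i) =
   (\<Prod>i\<in>Poly_Mapping.keys a. y i ^ Poly_Mapping.lookup a i) *
   (\<Prod>i\<in>Poly_Mapping.keys b. (y i :: 'a) ^ Poly_Mapping.lookup b i)"
proof -
  let ?A = "Poly_Mapping.keys a \<union> Poly_Mapping.keys b"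
  have *: "(\<Prod>i\<in>Poly_Mapping.keys m. y i ^ Poly_Mapping.lookup m i) =
      (\<Prod>i\<in>?A. y i ^ Poly_Mapping.lookup m i)" if "Poly_Mapping.keys m \<subseteq> ?A" for m
    using that by (intro prod.mono_neutral_left) (auto simp: in_keys_iff)
  show ?thesis
    using *[OF keys_add] *[of a] *[of b] by (simp add: lookup_add power_add prod.distrib)
qed

lemma ev_mult: "ev y (p * q) = ev y p * ev y q"
proof (induction p rule: cpoly_single_induct)
  case (single m c)
  show ?case
  proof (induction q rule: cpoly_single_induct)
    case (single m' c')
    show ?case by (simp add: mult_single ev_single mon_value_add hom_mult mult_ac)
  qed (simp add: ev_add distrib_left)
qed (simp add: ev_add distrib_right)

lemma ev_Const [simp]: "ev y (Const c) = \<phi> c"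
  by (simp add: Const_def ev_single)

lemma ev_0 [simp]: "ev y 0 = 0"
  by (simp add: ev_def)

lemma ev_1 [simp]: "ev y 1 = 1"
  using ev_Const[of y 1] by (simp add: hom_1)

lemma ev_Var [simp]: "ev y (Var i) = y i"
  by (simp add: Var_def ev_single hom_1)

lemma ev_sum: "ev y (\<Sum>x\<in>A. p x) = (\<Sum>x\<in>A. ev y (p x))"
  by (induction A rule: infinite_finite_induct) (auto simp: ev_add)

lemma ev_uminus: "ev y (- p) = - ev y p"
  using ev_add[of y p "- p"] by (simp add: eq_neg_iff_add_eq_0 add.commute)

lemma ev_diff: "ev y (p - q) = ev y p - ev y q"
  using ev_add[of y p "- q"] by (simp add: ev_uminus)

lemma ev_cong:
  assumes "vars p \<subseteq> I" "\<And>i. i \<in> I \<Longrightarrow> y i = z i"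
  shows "ev y p = ev z p"
  using assms(1) by (induction p rule: cpoly_induct) (auto simp: ev_add ev_mult assms)

text \<open>Holds for every derivation \<open>\<delta>\<close> that kills constants, by the product
  rule and induction on \<open>p\<close>. It is applied to \<open>partial\<close> after a
  substitution and to \<open>pderiv\<close> along a curve.\<close>

lemma ev_chain_rule:
  assumes \<delta>: "\<And>a b. \<delta> (a + b) = \<delta> a + \<delta> b" "\<And>a b. \<delta> (a * b) = \<delta> a * b + a * \<delta> b"
    "\<And>c. \<delta> (\<phi> c) = 0"
    and "finite I" "vars p \<subseteq> I"
  shows "\<delta> (ev y p) = (\<Sum>i\<in>I. ev y (partial i p) * \<delta> (y i))"
  using assms(5)
proof (induction p rule: cpoly_induct)
  case (Var_mult j p)
  have "(\<Sum>i\<in>I. ev y (partial i (Var j * p)) * \<delta> (y i)) =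
     (\<Sum>i\<in>I. (if i = j then ev y p * \<delta> (y i) else 0) + y j * (ev y (partial i p) * \<delta> (y i)))"
    by (intro sum.cong) (auto simp: partial_mult partial_Var ev_add ev_mult algebra_simps)
  also have "\<dots> = ev y p * \<delta> (y j) + y j * (\<Sum>i\<in>I. ev y (partial i p) * \<delta> (y i))"
    using Var_mult.hyps \<open>finite I\<close>
    by (simp add: sum.distrib sum_distrib_left)
  finally show ?case
    by (simp add: ev_mult \<delta> Var_mult.IH mult.commute)
qed (auto simp: \<delta> ev_add partial_add distrib_right sum.distrib)

end

interpretation pe: coeff_hom "\<lambda>c. c :: complex"
  rewrites "pe.ev y p = poly_eval p y"
proof -
  show "coeff_hom (\<lambda>c. c :: complex)" by unfold_locales auto
  then show "coeff_hom.ev (\<lambda>c. c) y p = poly_eval p y"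
    by (simp add: coeff_hom.ev_def poly_eval_def)
qed

interpretation ps: coeff_hom Const
  rewrites "ps.ev \<sigma> p = poly_subst \<sigma> p"
proof -
  show "coeff_hom Const" by unfold_locales (auto simp: Const_add Const_mult)
  then show "coeff_hom.ev Const \<sigma> p = poly_subst \<sigma> p"
    by (simp add: coeff_hom.ev_def poly_subst_def)
qed

interpretation pp: coeff_hom "\<lambda>c. [:c:] :: complex Polynomial.poly"
  by unfold_locales auto

section \<open>Homogeneous components of the Jacobian ideal\<close>

definition hom_part :: "nat \<Rightarrow> cpoly \<Rightarrow> cpoly" where
  "hom_part k p = (\<Sum>m\<in>{m \<in> Poly_Mapping.keys p. mon_degree m = k}.
     Poly_Mapping.single m (Poly_Mapping.lookup p m))"

lemma lookup_hom_part:
  "Poly_Mapping.lookup (hom_part k p) m = (if mon_degree m = k then Poly_Mapping.lookup p m else 0)"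
  by (auto simp: hom_part_def lookup_sum lookup_single when_def in_keys_iff sum.delta)

lemma hom_part_forms:
  assumes "vars p \<subseteq> I" shows "hom_part k p \<in> forms I k"
  unfolding forms_iff
proof
  fix m assume "m \<in> Poly_Mapping.keys (hom_part k p)"
  then have "m \<in> Poly_Mapping.keys p \<and> mon_degree m = k"
    unfolding in_keys_iff lookup_hom_part by (simp split: if_splits)
  then show "Poly_Mapping.keys m \<subseteq> I \<and> mon_degree m = k"
    using assms unfolding vars_def by blast
qed

text \<open>Coefficients of a homogeneous combination of forms of degree \<open>e\<close> may be cut
  down to their parts of degree \<open>k\<close>: the discarded parts contribute only to degrees
  other than \<open>k + e\<close>.\<close>

lemma hom_part_sum_mult:
  assumes "\<And>i. i \<in> A \<Longrightarrow> g i \<in> forms I e"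
    and "(\<Sum>i\<in>A. a i * g i) \<in> forms I (k + e)"
  shows "(\<Sum>i\<in>A. a i * g i) = (\<Sum>i\<in>A. hom_part k (a i) * g i)"
proof -
  let ?r = "\<lambda>i. a i - hom_part k (a i)"
  let ?d = "\<Sum>i\<in>A. ?r i * g i"
  \<comment> \<open>\<open>?d\<close> vanishes in degree \<open>k + e\<close> because no
    \<open>?r i\<close> has a term of degree \<open>k\<close>, and in all other degrees because both
    sums on the right are homogeneous of degree \<open>k + e\<close>.\<close>
  have d: "?d = (\<Sum>i\<in>A. a i * g i) - (\<Sum>i\<in>A. hom_part k (a i) * g i)"
    by (simp add: left_diff_distrib sum_subtractf)
  have "Poly_Mapping.lookup ?d m = 0" for m
  proof (cases "mon_degree m = k + e")
    case True
    have "Poly_Mapping.lookup (?r i * g i) m = 0" if i: "i \<in> A" for i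
    proof (rule ccontr)
      assume "Poly_Mapping.lookup (?r i * g i) m \<noteq> 0"
      then have "m \<in> Poly_Mapping.keys (?r i * g i)" unfolding in_keys_iff .
      then obtain b c where bc: "m = b + c" "b \<in> Poly_Mapping.keys (?r i)"
        "c \<in> Poly_Mapping.keys (g i)"
        using keys_mult[of "?r i" "g i"] by blast
      have "mon_degree b \<noteq> k"
        using bc(2) by (auto simp: in_keys_iff lookup_minus lookup_hom_part)
      moreover have "mon_degree c = e"
        using bc(3) assms(1)[OF i] by (auto simp: forms_iff)
      ultimately show False using True bc(1) by (simp add: mon_degree_add)
    qed
    then show ?thesis by (simp add: lookup_sum)
  next
    case False
    have "Poly_Mapping.lookup (\<Sum>i\<in>A. a i * g i) m = 0"
    proof -
      have "m \<notin> Poly_Mapping.keys (\<Sum>i\<in>A. a i * g i)"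
        using assms(2) False unfolding forms_iff by blast
      then show ?thesis by (simp add: in_keys_iff)
    qed
    moreover have "Poly_Mapping.lookup (hom_part k (a i) * g i) m = 0" if i: "i \<in> A" for i
    proof (rule ccontr)
      assume "Poly_Mapping.lookup (hom_part k (a i) * g i) m \<noteq> 0"
      then have "m \<in> Poly_Mapping.keys (hom_part k (a i) * g i)" unfolding in_keys_iff .
      then obtain b c where bc: "m = b + c" "b \<in> Poly_Mapping.keys (hom_part k (a i))"
        "c \<in> Poly_Mapping.keys (g i)"
        using keys_mult[of "hom_part k (a i)" "g i"] by blast
      have "mon_degree b = k"
        using bc(2) by (auto simp: in_keys_iff lookup_hom_part split: if_splits)
      moreover have "mon_degree c = e"
        using bc(3) assms(1)[OF i] by (auto simp: forms_iff)
      ultimately show False using False bc(1) by (simp add: mon_degree_add)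
    qed
    ultimately show ?thesis unfolding d by (simp add: lookup_minus lookup_sum)
  qed
  then have "?d = 0" by (intro poly_mapping_eqI) simp
  then show ?thesis using d by simp
qed

section \<open>Explicit elements of the Jacobian ideal and of the Milnor algebra\<close>

lemma carrier_poly_ring: "p \<in> carrier (poly_ring I) \<longleftrightarrow> vars p \<subseteq> I"
  by (simp add: poly_ring_def)

lemma poly_ring_simps [simp]:
  "\<zero>\<^bsub>poly_ring I\<^esub> = 0" "p \<oplus>\<^bsub>poly_ring I\<^esub> q = p + q" "p \<otimes>\<^bsub>poly_ring I\<^esub> q = p * q"
  by (simp_all add: poly_ring_def)

lemma vars_zero [simp]: "vars 0 = {}"
  by (simp add: vars_def)

lemma vars_sum:
  "(\<And>x. x \<in> A \<Longrightarrow> vars (p x) \<subseteq> I) \<Longrightarrow> vars (\<Sum>x\<in>A. p x) \<subseteq> I"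
proof (induction A rule: infinite_finite_induct)
  case (insert x A)
  have "vars (p x + (\<Sum>x\<in>A. p x)) \<subseteq> I"
    by (rule order.trans[OF vars_add]) (use insert in simp)
  then show ?case using insert.hyps by simp
qed auto

lemma poly_ring_a_inv:
  assumes "vars p \<subseteq> I" shows "\<ominus>\<^bsub>poly_ring I\<^esub> p = - p"
proof -
  interpret cring "poly_ring I" by (rule cring_poly_ring)
  show ?thesis
    using assms by (intro minus_equality) (auto simp: carrier_poly_ring vars_uminus)
qed

lemma poly_ring_a_minus:
  assumes "vars p \<subseteq> I" "vars q \<subseteq> I" shows "p \<ominus>\<^bsub>poly_ring I\<^esub> q = p - q"
  using assms by (simp add: a_minus_def poly_ring_a_inv)

lemma jac_ideal_is_ideal:
  assumes "vars g \<subseteq> I"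
  shows "ideal (jac_ideal I g) (poly_ring I)"
proof -
  interpret cring "poly_ring I" by (rule cring_poly_ring)
  show ?thesis unfolding jac_ideal_def
    using partial_vars[OF assms] by (intro genideal_ideal) (auto simp: carrier_poly_ring)
qed

text \<open>The combinations form an ideal containing the generators, so minimality gives one
  inclusion; the closure properties of the generated ideal give the other.\<close>

lemma jac_ideal_eq:
  assumes "finite I" "vars g \<subseteq> I"
  shows "jac_ideal I g = {\<Sum>i\<in>I. a i * partial i g | a. \<forall>i\<in>I. vars (a i) \<subseteq> I}"
    (is "_ = ?J")
proof
  interpret cring "poly_ring I" by (rule cring_poly_ring)
  note pv = partial_vars[OF assms(2)]
  have ideal: "ideal ?J (poly_ring I)"
  proof (rule idealI)
    show "ring (poly_ring I)" by (rule ring_axioms)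
    show "subgroup ?J (add_monoid (poly_ring I))"
    proof (rule add.subgroupI)
      show "?J \<subseteq> carrier (poly_ring I)"
      proof
        fix p assume "p \<in> ?J"
        then obtain a where a: "p = (\<Sum>i\<in>I. a i * partial i g)" "\<forall>i\<in>I. vars (a i) \<subseteq> I" by blast
        have "vars p \<subseteq> I" unfolding a(1)
          by (rule vars_sum, rule order.trans[OF vars_mult]) (use pv a(2) in simp)
        then show "p \<in> carrier (poly_ring I)" by (simp add: carrier_poly_ring)
      qed
      show "?J \<noteq> {}"
        by (auto intro!: exI[of _ "\<lambda>_. 0"])
    next
      fix p assume "p \<in> ?J"
      then obtain a where a: "p = (\<Sum>i\<in>I. a i * partial i g)" "\<forall>i\<in>I. vars (a i) \<subseteq> I" by blast
      have "vars p \<subseteq> I" unfolding a(1)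
        by (rule vars_sum, rule order.trans[OF vars_mult]) (use pv a(2) in simp)
      moreover have "- p = (\<Sum>i\<in>I. (- a i) * partial i g)" by (simp add: a(1) sum_negf)
      ultimately show "\<ominus>\<^bsub>poly_ring I\<^esub> p \<in> ?J"
        unfolding mem_Collect_eq using a(2)
        by (intro exI[of _ "\<lambda>i. - a i"]) (simp add: poly_ring_a_inv vars_uminus)
    next
      fix p q assume "p \<in> ?J" "q \<in> ?J"
      then obtain a b where a: "p = (\<Sum>i\<in>I. a i * partial i g)" "\<forall>i\<in>I. vars (a i) \<subseteq> I"
        and b: "q = (\<Sum>i\<in>I. b i * partial i g)" "\<forall>i\<in>I. vars (b i) \<subseteq> I" by blast
      have "p + q = (\<Sum>i\<in>I. (a i + b i) * partial i g)"
        by (simp add: a(1) b(1) sum.distrib distrib_right)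
      moreover have "\<forall>i\<in>I. vars (a i + b i) \<subseteq> I" using a(2) b(2) vars_add by blast
      ultimately show "p \<oplus>\<^bsub>poly_ring I\<^esub> q \<in> ?J"
        unfolding mem_Collect_eq by (intro exI[of _ "\<lambda>i. a i + b i"]) simp
    qed
  next
    fix p q assume "p \<in> ?J" and q: "q \<in> carrier (poly_ring I)"
    then obtain a where a: "p = (\<Sum>i\<in>I. a i * partial i g)" "\<forall>i\<in>I. vars (a i) \<subseteq> I" by blast
    have "q * p = (\<Sum>i\<in>I. (q * a i) * partial i g)"
      by (simp add: a(1) sum_distrib_left mult.assoc)
    moreover have "\<forall>i\<in>I. vars (q * a i) \<subseteq> I"
      using a(2) q by (auto simp: carrier_poly_ring intro!: order.trans[OF vars_mult])
    ultimately have "q * p \<in> ?J"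
      unfolding mem_Collect_eq by (intro exI[of _ "\<lambda>i. q * a i"]) simp
    then show "q \<otimes>\<^bsub>poly_ring I\<^esub> p \<in> ?J" "p \<otimes>\<^bsub>poly_ring I\<^esub> q \<in> ?J"
      by (simp_all add: mult.commute)
  qed
  have "partial i g \<in> ?J" if "i \<in> I" for i
  proof -
    have "partial i g = (\<Sum>j\<in>I. (if j = i then 1 else 0) * partial j g)"
      using that assms(1) by (simp add: if_distrib[of "\<lambda>x. x * _"] cong: if_cong)
    moreover have "\<forall>j\<in>I. vars (if j = i then 1 else 0) \<subseteq> I" by (auto simp: vars_def)
    ultimately show ?thesis
      unfolding mem_Collect_eq by (intro exI[of _ "\<lambda>j. if j = i then 1 else 0"]) simp
  qed
  then show "jac_ideal I g \<subseteq> ?J"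
    unfolding jac_ideal_def by (intro genideal_minimal[OF ideal]) auto
  interpret J: ideal "jac_ideal I g" "poly_ring I" by (rule jac_ideal_is_ideal[OF assms(2)])
  have gen: "partial i g \<in> jac_ideal I g" if "i \<in> I" for i
    unfolding jac_ideal_def
    by (rule subsetD[OF genideal_self]) (use that pv in \<open>simp_all add: image_subset_iff carrier_poly_ring\<close>)
  show "?J \<subseteq> jac_ideal I g"
  proof
    fix p assume "p \<in> ?J"
    then obtain a where a: "p = (\<Sum>i\<in>I. a i * partial i g)" "\<forall>i\<in>I. vars (a i) \<subseteq> I" by blast
    have "(\<Sum>i\<in>A. a i * partial i g) \<in> jac_ideal I g" if "finite A" "A \<subseteq> I" for A
      using that
    proof (induction A rule: finite_induct)
      case empty
      show ?case using J.zero_closed by simp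
    next
      case (insert i A)
      have "a i \<otimes>\<^bsub>poly_ring I\<^esub> partial i g \<in> jac_ideal I g"
        using insert.prems a(2) by (intro J.I_l_closed gen) (auto simp: carrier_poly_ring)
      then show ?case
        using insert J.a_closed[of "a i * partial i g" "\<Sum>i\<in>A. a i * partial i g"] by simp
    qed
    then show "p \<in> jac_ideal I g" using assms(1) a(1) by blast
  qed
qed

text \<open>The partial derivatives have degree \<open>e\<close>, so by homogeneity the coefficients
  can be chosen as forms of degree \<open>k\<close>. The cases \<open>k = 0\<close> and
  \<open>k = 1\<close> supply constant and linear relations.\<close>

lemma jac_ideal_forms_iff:
  assumes "finite I" "g \<in> forms I (Suc e)" "h \<in> forms I (k + e)"
  shows "h \<in> jac_ideal I g \<longleftrightarrow>
    (\<exists>a. (\<forall>i\<in>I. a i \<in> forms I k) \<and> h = (\<Sum>i\<in>I. a i * partial i g))"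
proof
  assume "h \<in> jac_ideal I g"
  then obtain a where a: "h = (\<Sum>i\<in>I. a i * partial i g)" "\<forall>i\<in>I. vars (a i) \<subseteq> I"
    using jac_ideal_eq[OF assms(1) forms_vars[OF assms(2)]] by blast
  have "h = (\<Sum>i\<in>I. hom_part k (a i) * partial i g)"
    unfolding a(1) using partial_forms[OF assms(2)] assms(3) a(1)
    by (intro hom_part_sum_mult) auto
  moreover have "\<forall>i\<in>I. hom_part k (a i) \<in> forms I k"
    using a(2) hom_part_forms by simp
  ultimately show "\<exists>a. (\<forall>i\<in>I. a i \<in> forms I k) \<and> h = (\<Sum>i\<in>I. a i * partial i g)"
    by (intro exI[of _ "\<lambda>i. hom_part k (a i)"]) simp
next
  assume "\<exists>a. (\<forall>i\<in>I. a i \<in> forms I k) \<and> h = (\<Sum>i\<in>I. a i * partial i g)"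
  then show "h \<in> jac_ideal I g"
    unfolding jac_ideal_eq[OF assms(1) forms_vars[OF assms(2)]] mem_Collect_eq
    by (elim exE) (rule_tac x=a in exI, use forms_vars in blast)
qed

text \<open>Multiplication is additive and differences of forms of degree \<open>k\<close> are again
  such forms, so injectivity becomes triviality of the kernel, expressed through
  representatives.\<close>

lemma inj_on_milnor_mult_iff:
  assumes "vars g \<subseteq> I" "vars q \<subseteq> I"
  shows "inj_on (milnor_mult I g q) (milnor_component I g k) \<longleftrightarrow>
    (\<forall>h\<in>forms I k. q * h \<in> jac_ideal I g \<longrightarrow> h \<in> jac_ideal I g)"
proof -
  interpret cring "poly_ring I" by (rule cring_poly_ring)
  let ?J = "jac_ideal I g"
  interpret J: ideal ?J "poly_ring I" by (rule jac_ideal_is_ideal[OF assms(1)])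
  have qh: "vars (q * h) \<subseteq> I" if "vars h \<subseteq> I" for h
    using that assms(2) vars_mult by blast
  have coset: "?J +>\<^bsub>poly_ring I\<^esub> a = ?J +>\<^bsub>poly_ring I\<^esub> b \<longleftrightarrow> a - b \<in> ?J"
    if "vars a \<subseteq> I" "vars b \<subseteq> I" for a b
    using quotient_eq_iff_same_a_r_cos[OF J.ideal_axioms, of a b] that
    by (simp add: carrier_poly_ring poly_ring_a_minus)
  have mult: "milnor_mult I g q (?J +>\<^bsub>poly_ring I\<^esub> h) = ?J +>\<^bsub>poly_ring I\<^esub> (q * h)"
    if "vars h \<subseteq> I" for h
    unfolding milnor_mult_def milnor_algebra_def FactRing_def
    using J.rcoset_mult_add[of q h] that assms(2) by (simp add: carrier_poly_ring)
  show ?thesis (is "?L = ?R")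
  proof
    assume inj: ?L
    show ?R
    proof (intro ballI impI)
      fix h assume h: "h \<in> forms I k" "q * h \<in> ?J"
      have "milnor_mult I g q (?J +>\<^bsub>poly_ring I\<^esub> h) = milnor_mult I g q (?J +>\<^bsub>poly_ring I\<^esub> 0)"
        using h forms_vars[OF h(1)] qh by (simp add: mult coset)
      then have "?J +>\<^bsub>poly_ring I\<^esub> h = ?J +>\<^bsub>poly_ring I\<^esub> 0"
        using inj h(1) forms_zero by (auto simp: inj_on_def milnor_component_def)
      then show "h \<in> ?J" using forms_vars[OF h(1)] by (simp add: coset)
    qed
  next
    assume R: ?R
    show ?L
    proof (rule inj_onI)
      fix c c' assume "c \<in> milnor_component I g k" "c' \<in> milnor_component I g k"
        and eq: "milnor_mult I g q c = milnor_mult I g q c'"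
      then obtain h h' where h: "h \<in> forms I k" "c = ?J +>\<^bsub>poly_ring I\<^esub> h"
        and h': "h' \<in> forms I k" "c' = ?J +>\<^bsub>poly_ring I\<^esub> h'"
        by (auto simp: milnor_component_def)
      have "q * (h - h') \<in> ?J"
        using eq forms_vars[OF h(1)] forms_vars[OF h'(1)] qh
        by (simp add: h(2) h'(2) mult coset right_diff_distrib)
      then have "h - h' \<in> ?J" using R forms_diff[OF h(1) h'(1)] by blast
      then show "c = c'"
        using forms_vars[OF h(1)] forms_vars[OF h'(1)] by (simp add: h(2) h'(2) coset)
    qed
  qed
qed

section \<open>Restriction to the hyperplane\<close>

text \<open>Restriction keeps the monomials free of variable 0 and kills the others. All later
  coefficient computations for \<open>restrict0\<close> rest on this.\<close>

lemma restrict0_single: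
  "restrict0 (Poly_Mapping.single m c) =
     (if Poly_Mapping.lookup m 0 = 0 then Poly_Mapping.single m c else 0)"
proof (cases "Poly_Mapping.lookup m 0 = 0")
  case True
  let ?y = "\<lambda>i. if i = 0 then 0 else Var i"
  have "restrict0 (Poly_Mapping.single m c) = poly_subst Var (Poly_Mapping.single m c)"
    unfolding restrict0_def
    by (rule ps.ev_cong[where I = "Poly_Mapping.keys m"]) (use True in \<open>auto simp: vars_def in_keys_iff\<close>)
  also have "poly_subst Var p = p" for p
    using subset_UNIV
    by (induction p rule: cpoly_induct) (auto simp: ps.ev_add ps.ev_mult)
  finally show ?thesis using True by simp
next
  case False
  then show ?thesis unfolding restrict0_def
    by (subst single_eq_Var_mult[OF False]) (simp add: ps.ev_mult)
qed

lemma restrict0_add: "restrict0 (p + q) = restrict0 p + restrict0 q"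
  by (simp add: restrict0_def ps.ev_add)

lemma restrict0_mult: "restrict0 (p * q) = restrict0 p * restrict0 q"
  by (simp add: restrict0_def ps.ev_mult)

lemma restrict0_sum: "restrict0 (\<Sum>x\<in>A. p x) = (\<Sum>x\<in>A. restrict0 (p x))"
  by (simp add: restrict0_def ps.ev_sum)

lemma restrict0_diff: "restrict0 (p - q) = restrict0 p - restrict0 q"
  by (simp add: restrict0_def ps.ev_diff)

lemma restrict0_Const [simp]: "restrict0 (Const c) = Const c"
  by (simp add: restrict0_def)

lemma restrict0_0 [simp]: "restrict0 0 = 0"
  by (simp add: restrict0_def)

lemma restrict0_Var: "restrict0 (Var i) = (if i = 0 then 0 else Var i)"
  by (simp add: restrict0_def)

lemma lookup_restrict0: "Poly_Mapping.lookup (restrict0 p) m =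
    (if Poly_Mapping.lookup m 0 = 0 then Poly_Mapping.lookup p m else 0)"
  by (induction p rule: cpoly_single_induct)
     (auto simp: restrict0_single restrict0_add lookup_add lookup_single when_def)

lemma restrict0_forms:
  assumes "p \<in> forms {0..n} k" shows "restrict0 p \<in> forms {1..n} k"
  unfolding forms_iff
proof
  fix m assume "m \<in> Poly_Mapping.keys (restrict0 p)"
  then have m: "Poly_Mapping.lookup m 0 = 0" "m \<in> Poly_Mapping.keys p"
    by (simp_all add: in_keys_iff lookup_restrict0 split: if_splits)
  then have "Poly_Mapping.keys m \<subseteq> {0..n} - {0}" "mon_degree m = k"
    using assms by (auto simp: forms_iff in_keys_iff)
  moreover have "{0..n} - {0} = {1..n}" by auto
  ultimately show "Poly_Mapping.keys m \<subseteq> {1..n} \<and> mon_degree m = k" by simp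
qed

lemma restrict0_id:
  assumes "p \<in> forms {1..n} k" shows "restrict0 p = p"
proof (rule poly_mapping_eqI)
  fix m
  have "Poly_Mapping.lookup m 0 = 0" if "m \<in> Poly_Mapping.keys p"
  proof -
    have "Poly_Mapping.keys m \<subseteq> {1..n}" using that assms unfolding forms_iff by blast
    then have "0 \<notin> Poly_Mapping.keys m" by auto
    then show ?thesis by (simp add: in_keys_iff)
  qed
  then show "Poly_Mapping.lookup (restrict0 p) m = Poly_Mapping.lookup p m"
    unfolding lookup_restrict0 in_keys_iff by metis
qed

text \<open>Chain rule for the substitution of 0 for variable 0: since \<open>i\<close> is not 0,
  only the summand \<open>j = i\<close> survives.\<close>

lemma partial_restrict0:
  assumes "vars f \<subseteq> {0..n}" "i \<in> {1..n}"
  shows "partial i (restrict0 f) = restrict0 (partial i f)"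
proof -
  have "partial i (restrict0 f) = (\<Sum>j\<in>{0..n}. restrict0 (partial j f) *
      partial i (if j = 0 then 0 else Var j))"
    unfolding restrict0_def
    by (rule ps.ev_chain_rule) (use assms in \<open>auto simp: partial_add partial_mult\<close>)
  also have "\<dots> = (\<Sum>j\<in>{0..n}. if j = i then restrict0 (partial j f) else 0)"
    using assms(2) by (intro sum.cong) (auto simp: partial_Var)
  finally show ?thesis using assms(2) by (simp add: sum.delta)
qed

text \<open>Every monomial of a form vanishing on the hyperplane contains variable 0; lowering that
  exponent by one in each monomial gives the quotient \<open>q\<close>.\<close>

lemma restrict0_eq_0:
  assumes "p \<in> forms {0..n} (Suc k)" "restrict0 p = 0"
  obtains q where "q \<in> forms {0..n} k" "p = Var 0 * q"
proof -
  let ?m = "\<lambda>m. m - Poly_Mapping.single 0 (1::nat)"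
  let ?q = "\<Sum>m\<in>Poly_Mapping.keys p. Poly_Mapping.single (?m m) (Poly_Mapping.lookup p m)"
  have 0: "Poly_Mapping.lookup m 0 \<noteq> 0" if "m \<in> Poly_Mapping.keys p" for m
    using that arg_cong[OF assms(2), of "\<lambda>p. Poly_Mapping.lookup p m"]
    unfolding lookup_restrict0 in_keys_iff by (simp split: if_splits)
  have "?q \<in> forms {0..n} k"
  proof (rule forms_sum)
    fix m assume m: "m \<in> Poly_Mapping.keys p"
    have "mon_degree m = 1 + mon_degree (?m m)"
      using mon_split[OF 0[OF m]] mon_degree_add[of "Poly_Mapping.single 0 1" "?m m"] by simp
    then show "Poly_Mapping.single (?m m) (Poly_Mapping.lookup p m) \<in> forms {0..n} k"
      using assms(1) m keys_diff_single_subset[of m 0] by (fastforce simp: forms_iff)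
  qed
  moreover have "p = Var 0 * ?q"
  proof -
    have "p = (\<Sum>m\<in>Poly_Mapping.keys p. Var 0 * Poly_Mapping.single (?m m) (Poly_Mapping.lookup p m))"
      by (subst cpoly_eq_sum_single, rule sum.cong[OF refl], rule single_eq_Var_mult, rule 0)
    then show ?thesis by (simp add: sum_distrib_left)
  qed
  ultimately show ?thesis using that by blast
qed

section \<open>Nilpotent matrices\<close>

lemma diag_block_mat_zero:
  "(\<And>B. B \<in> set Bs \<Longrightarrow> \<exists>m. B = 0\<^sub>m m m) \<Longrightarrow> \<exists>m. diag_block_mat Bs = 0\<^sub>m m m"
proof (induction Bs)
  case (Cons B Bs)
  then obtain m m' where "B = 0\<^sub>m m m" "diag_block_mat Bs = 0\<^sub>m m' m'"
    by (meson list.set_intros)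
  then show ?case by (auto simp: Let_def intro!: exI[of _ "m + m'"])
qed auto

text \<open>In Jordan form all blocks belong to the eigenvalue 0, so any power at least as large as
  every block size vanishes.\<close>

lemma nilpotent_if_eigenvalues_zero:
  fixes A :: "complex mat"
  assumes A: "A \<in> carrier_mat n n" and ev: "\<And>k. eigenvalue A k \<Longrightarrow> k = 0"
  shows "\<exists>p. A ^\<^sub>m p = 0\<^sub>m n n"
proof -
  obtain as where "char_poly A = (\<Prod>a\<leftarrow>as. [:- a, 1:])"
    using char_poly_factorized[OF A] by blast
  from jordan_nf_exists[OF A this] obtain n_as where jnf: "jordan_nf A n_as" ..
  obtain P Q where PQ: "P \<in> carrier_mat n n" "Q \<in> carrier_mat n n"
    and cp: "char_poly A = (\<Prod>(na, a)\<leftarrow>n_as. [:- a, 1:] ^ na)"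
    and pow: "\<And>k. A ^\<^sub>m k = P * (jordan_matrix n_as) ^\<^sub>m k * Q"
    using jordan_nf_powE[OF A jnf] by metis
  \<comment> \<open>The sum of the block sizes serves as a common bound for all of them.\<close>
  define N where "N = sum_list (map fst n_as)"
  have zero: "a = 0" "m \<le> N" if "(m, a) \<in> set n_as" for m a
  proof -
    have "m \<noteq> 0" using that jnf by (force simp: jordan_nf_def)
    moreover have "poly (char_poly A) a = (\<Prod>x\<leftarrow>n_as. poly (case x of (na, a) \<Rightarrow> [:- a, 1:] ^ na) a)"
      unfolding cp by (simp add: poly_prod_list o_def)
    ultimately have "poly (char_poly A) a = 0"
      using that by (force simp: prod_list_zero_iff)
    then show "a = 0" using ev eigenvalue_root_char_poly[OF A] by blast
    show "m \<le> N" unfolding N_def using that by (intro member_le_sum_list) force+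
  qed
  have "\<exists>m. diag_block_mat (map (\<lambda>(m, a). jordan_block m a ^\<^sub>m N) n_as) = 0\<^sub>m m m"
  proof (rule diag_block_mat_zero)
    fix B assume "B \<in> set (map (\<lambda>(m, a). jordan_block m a ^\<^sub>m N) n_as)"
    then obtain m a where ma: "(m, a) \<in> set n_as" "B = jordan_block m a ^\<^sub>m N" by auto
    have "B = 0\<^sub>m m m"
      unfolding ma(2) zero(1)[OF ma(1)] jordan_block_zero_pow
      using zero(2)[OF ma(1)] by (intro eq_matI) auto
    then show "\<exists>m. B = 0\<^sub>m m m" ..
  qed
  then obtain m where m: "jordan_matrix n_as ^\<^sub>m N = 0\<^sub>m m m"
    by (auto simp: jordan_matrix_pow)
  have "A ^\<^sub>m N = P * 0\<^sub>m m m * Q" using pow[of N] m by simp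
  \<comment> \<open>The size of the zero block matrix was obtained only existentially and has to be
    matched with that of \<open>A\<close>.\<close>
  moreover have "m = n"
  proof -
    have "similar_mat A (jordan_matrix n_as)" using jnf by (simp add: jordan_nf_def)
    then have "jordan_matrix n_as \<in> carrier_mat n n"
      using A by (auto simp: similar_mat_def similar_mat_wit_def Let_def)
    then have "jordan_matrix n_as ^\<^sub>m N \<in> carrier_mat n n" by simp
    then show ?thesis unfolding m by auto
  qed
  ultimately show ?thesis using PQ by auto
qed

lemma pow_mat_Suc_left:
  assumes "A \<in> carrier_mat n n"
  shows "A ^\<^sub>m Suc k = A * A ^\<^sub>m k"
proof (induction k)
  case (Suc k)
  have "A ^\<^sub>m Suc (Suc k) = A * A ^\<^sub>m k * A" using Suc by simp
  also have "\<dots> = A * A ^\<^sub>m Suc k"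
    using assms by (simp add: assoc_mult_mat[OF assms pow_carrier_mat[OF assms] assms])
  finally show ?case .
qed (use assms in simp)

section \<open>Leading coefficients along polynomial curves\<close>

text \<open>Works with degree bounds instead of degrees: if one bound is not attained, both sides
  are 0. Leading coefficients along a curve may thus be computed without knowing whether they
  vanish.\<close>

lemma coeff_mult_degree_bounds:
  assumes "Polynomial.degree p \<le> m" "Polynomial.degree q \<le> n"
  shows "Polynomial.coeff (p * q) (m + n) = Polynomial.coeff p m * Polynomial.coeff q n"
proof (cases "Polynomial.degree p = m \<and> Polynomial.degree q = n")
  case True
  then show ?thesis by (auto simp: coeff_mult_degree_sum)
next
  case False
  then have "Polynomial.degree p + Polynomial.degree q < m + n" using assms by linarith
  then have "Polynomial.degree (p * q) < m + n" using degree_mult_le le_less_trans by blast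
  moreover have "Polynomial.coeff p m * Polynomial.coeff q n = 0"
    using False assms by (metis coeff_eq_0 le_neq_implies_less mult_zero_left mult_zero_right)
  ultimately show ?thesis by (simp add: coeff_eq_0)
qed

lemma coeff_power_degree_bound:
  fixes p :: "'a :: comm_semiring_1 Polynomial.poly"
  assumes "Polynomial.degree p \<le> q"
  shows "Polynomial.degree (p ^ k) \<le> q * k \<and> Polynomial.coeff (p ^ k) (q * k) = Polynomial.coeff p q ^ k"
proof (induction k)
  case (Suc k)
  then show ?case
    using assms degree_mult_le[of p "p ^ k"] coeff_mult_degree_bounds[of p q "p ^ k" "q * k"]
    by auto
qed simp

lemma coeff_prod_power_degree_bound:
  fixes y :: "'b \<Rightarrow> 'a :: comm_semiring_1 Polynomial.poly"
  assumes "finite A" "\<And>i. i \<in> A \<Longrightarrow> Polynomial.degree (y i) \<le> q"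
  shows "Polynomial.degree (\<Prod>i\<in>A. y i ^ k i) \<le> q * (\<Sum>i\<in>A. k i) \<and>
    Polynomial.coeff (\<Prod>i\<in>A. y i ^ k i) (q * (\<Sum>i\<in>A. k i)) = (\<Prod>i\<in>A. Polynomial.coeff (y i) q ^ k i)"
  using assms
proof (induction A rule: finite_induct)
  case (insert i A)
  have i: "Polynomial.degree (y i ^ k i) \<le> q * k i"
    "Polynomial.coeff (y i ^ k i) (q * k i) = Polynomial.coeff (y i) q ^ k i"
    using coeff_power_degree_bound[of "y i" q "k i"] insert.prems by auto
  show ?case
    using insert i degree_mult_le[of "y i ^ k i" "\<Prod>i\<in>A. y i ^ k i"]
      coeff_mult_degree_bounds[OF i(1), of "\<Prod>i\<in>A. y i ^ k i" "q * (\<Sum>i\<in>A. k i)"]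
    by (auto simp: distrib_left)
qed simp

text \<open>By homogeneity every monomial of \<open>h\<close> contributes its top coefficient in the
  same degree \<open>q * e\<close>. That coefficient of \<open>h\<close> along the curve is
  therefore \<open>h\<close> at the vector of \<open>q\<close>-th coefficients of the curve.\<close>

lemma coeff_eval_form:
  assumes "h \<in> forms I e" "\<And>i. i \<in> I \<Longrightarrow> Polynomial.degree (y i) \<le> q"
  shows "Polynomial.coeff (pp.ev y h) (q * e) = poly_eval h (\<lambda>i. Polynomial.coeff (y i) q)"
  unfolding pp.ev_def poly_eval_def coeff_sum
proof (rule sum.cong[OF refl])
  fix m assume "m \<in> Poly_Mapping.keys h"
  then have m: "Poly_Mapping.keys m \<subseteq> I" "e = (\<Sum>i\<in>Poly_Mapping.keys m. Poly_Mapping.lookup m i)"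
    using assms(1) by (auto simp: forms_iff mon_degree_def)
  show "Polynomial.coeff ([:Poly_Mapping.lookup h m:] *
      (\<Prod>i\<in>Poly_Mapping.keys m. y i ^ Poly_Mapping.lookup m i)) (q * e) =
    Poly_Mapping.lookup h m *
      (\<Prod>i\<in>Poly_Mapping.keys m. Polynomial.coeff (y i) q ^ Poly_Mapping.lookup m i)"
    using coeff_prod_power_degree_bound[of "Poly_Mapping.keys m" y q "Poly_Mapping.lookup m"]
      assms(2) m by auto
qed

section \<open>Linear syzygies force singularities\<close>

text \<open>By contradiction the gradient has no nonzero zero. This makes the coefficient matrix of
  \<open>L\<close> nilpotent, and then the leading coefficient of an integral curve is such a zero
  after all.\<close>

lemma linear_syzygy_imp_singular:
  assumes g: "g \<in> forms {1..n} d" and d: "d \<ge> 3"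
    and L: "\<And>i. i \<in> {1..n} \<Longrightarrow> L i \<in> forms {1..n} 1"
    and syz: "(\<Sum>i\<in>{1..n}. L i * partial i g) = 0"
    and nz: "i0 \<in> {1..n}" "L i0 \<noteq> 0"
  shows "\<exists>u. (\<exists>i\<in>{1..n}. u i \<noteq> 0) \<and> (\<forall>i\<in>{1..n}. poly_eval (partial i g) u = 0)"
proof (rule ccontr)
  let ?I = "{1..n}"
  assume "\<not> ?thesis"
  then have smooth: "\<exists>i\<in>?I. poly_eval (partial i g) u \<noteq> 0" if "\<exists>i\<in>?I. u i \<noteq> 0" for u
    using that by blast
  define a where "a i j = Poly_Mapping.lookup (L i) (Poly_Mapping.single j 1)" for i j
  have La: "L i = (\<Sum>j\<in>?I. Const (a i j) * Var j)" if "i \<in> ?I" for i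
    unfolding a_def using forms_1_expand[OF L[OF that]] by simp
  have partial_L: "partial j (L i) = Const (a i j)" if "i \<in> ?I" "j \<in> ?I" for i j
  proof -
    have "partial j (L i) = (\<Sum>k\<in>?I. if k = j then Const (a i k) else 0)"
      unfolding La[OF that(1)] partial_sum
      by (intro sum.cong) (auto simp: partial_mult partial_Var)
    then show ?thesis using that by (simp add: sum.delta)
  qed
  \<comment> \<open>Differentiating the syzygy in direction \<open>j\<close>: the Hessian applied to
    \<open>L\<close> is minus the transposed coefficient matrix applied to the gradient.\<close>
  have key: "(\<Sum>i\<in>?I. L i * partial i (partial j g)) = - (\<Sum>i\<in>?I. Const (a i j) * partial i g)"
    if j: "j \<in> ?I" for j
  proof -
    have "0 = partial j (\<Sum>i\<in>?I. L i * partial i g)" unfolding syz by simp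
    also have "\<dots> = (\<Sum>i\<in>?I. Const (a i j) * partial i g + L i * partial i (partial j g))"
      unfolding partial_sum
      using j by (intro sum.cong) (auto simp: partial_mult partial_L partial_commute[of j])
    also have "\<dots> = (\<Sum>i\<in>?I. Const (a i j) * partial i g) + (\<Sum>i\<in>?I. L i * partial i (partial j g))"
      by (rule sum.distrib)
    finally show ?thesis by (simp only: eq_neg_iff_add_eq_0 add.commute)
  qed
  have gj: "partial j g \<in> forms ?I (d - 1)" for j by (rule partial_forms[OF g])
  \<comment> \<open>Matrix indices start at 0 and variables at 1; \<open>sum_shift\<close>
    translates between the two.\<close>
  define M where "M = mat n n (\<lambda>(r, s). a (Suc r) (Suc s))"
  have M: "M \<in> carrier_mat n n" by (simp add: M_def)
  have n0: "n > 0" using nz(1) by simp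
  have sum_shift: "(\<Sum>i\<in>?I. F i) = (\<Sum>r<n. F (Suc r))" for F :: "nat \<Rightarrow> 'z::comm_monoid_add"
    by (rule sum.reindex_bij_witness[of _ Suc "\<lambda>i. i - 1"]) auto

  have eigen: "k = 0" if k: "eigenvalue M k" for k
  proof -
    \<comment> \<open>An eigenvalue of maximal modulus; once it is 0, so is the given
      \<open>k\<close>.\<close>
    obtain l where l: "l \<in> spectrum M" "norm l = spectral_radius M"
      using spectral_radius_mem_max(1)[OF M n0] by auto
    obtain v where v: "v \<in> carrier_vec n" "v \<noteq> 0\<^sub>v n" "M *\<^sub>v v = l \<cdot>\<^sub>v v"
      using l(1) M by (auto simp: spectrum_def eigenvalue_def eigenvector_def)
    define u where "u i = v $ (i - 1)" for i
    obtain r where "r < n" "v $ r \<noteq> 0"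
      using v(1,2) by (metis carrier_vecD eq_vecI index_zero_vec)
    then have u: "\<exists>i\<in>?I. u i \<noteq> 0"
      by (intro bexI[of _ "Suc r"]) (auto simp: u_def)
    have Lu: "poly_eval (L i) u = l * u i" if i: "i \<in> ?I" for i
    proof -
      have "poly_eval (L i) u = (\<Sum>s<n. a i (Suc s) * v $ s)"
        unfolding La[OF i] pe.ev_sum pe.ev_mult pe.ev_Const pe.ev_Var sum_shift by (simp add: u_def)
      also have "\<dots> = (M *\<^sub>v v) $ (i - 1)"
        using i v(1) by (auto simp: M_def scalar_prod_def lessThan_atLeast0)
      also have "\<dots> = l * u i" using i v(1) by (auto simp: v(3) u_def)
      finally show ?thesis .
    qed
    \<comment> \<open>The gradient at the eigenvector, which is nonzero by
      \<open>smooth\<close>.\<close>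
    define w where "w = vec n (\<lambda>r. poly_eval (partial (Suc r) g) u)"
    have w0: "w \<noteq> 0\<^sub>v n"
    proof -
      obtain i where "i \<in> ?I" "poly_eval (partial i g) u \<noteq> 0" using smooth[OF u] by blast
      then have "w $ (i - 1) \<noteq> 0" "i - 1 < n" by (auto simp: w_def)
      then show ?thesis by auto
    qed
    \<comment> \<open>At \<open>u\<close> the forms \<open>L i\<close> take the values
      \<open>l * u i\<close>, so Euler's identity for the partial derivatives, of degree
      \<open>d - 1\<close>, turns \<open>key\<close> into an eigenvector equation for
      \<open>w\<close>.\<close>
    let ?k = "- (of_nat (d - 1) * l)"
    have "transpose_mat M *\<^sub>v w = ?k \<cdot>\<^sub>v w"
    proof (rule eq_vecI)
      fix r assume "r < dim_vec (?k \<cdot>\<^sub>v w)"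
      then have r: "r < n" by (simp add: w_def)
      have "(transpose_mat M *\<^sub>v w) $ r = (\<Sum>i\<in>?I. a i (Suc r) * poly_eval (partial i g) u)"
        using r unfolding sum_shift by (simp add: M_def w_def scalar_prod_def lessThan_atLeast0)
      also have "\<dots> = - (\<Sum>i\<in>?I. l * u i * poly_eval (partial i (partial (Suc r) g)) u)"
        using arg_cong[OF key[of "Suc r"], of "\<lambda>p. poly_eval p u"] r Lu
        by (simp add: pe.ev_sum pe.ev_mult pe.ev_uminus)
      also have "\<dots> = - l * poly_eval (\<Sum>i\<in>?I. Var i * partial i (partial (Suc r) g)) u"
        by (simp add: pe.ev_sum pe.ev_mult sum_distrib_left sum_negf mult.assoc)
      also have "\<dots> = - l * (of_nat (d - 1) * poly_eval (partial (Suc r) g) u)"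
        unfolding euler_identity[OF gj finite_atLeastAtMost] single_of_nat[symmetric]
        by (simp add: pe.ev_mult Const_def[symmetric])
      also have "\<dots> = (?k \<cdot>\<^sub>v w) $ r" using r by (simp add: w_def)
      finally show "(transpose_mat M *\<^sub>v w) $ r = (?k \<cdot>\<^sub>v w) $ r" .
    qed (use M in \<open>simp add: w_def\<close>)
    then have "eigenvalue (transpose_mat M) ?k"
      unfolding eigenvalue_def eigenvector_def using w0 M by (intro exI[of _ w]) (auto simp: w_def)
    \<comment> \<open>A matrix and its transpose share the characteristic polynomial. Hence the
      modulus of \<open>?k\<close> cannot exceed that of \<open>l\<close>, and
      \<open>d - 1 > 1\<close> forces \<open>l = 0\<close>.\<close>
    then have "?k \<in> spectrum M"
      using eigenvalue_root_char_poly[of "transpose_mat M" n ?k] eigenvalue_root_char_poly[OF M]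
        char_poly_transpose_mat[OF M] M by (simp add: spectrum_def)
    then have "norm ?k \<le> norm l"
      unfolding l(2) by (rule spectral_radius_mem_max(2)[OF M n0 imageI])
    then have "real (d - 1) * norm l \<le> 1 * norm l" by (simp add: norm_mult)
    moreover have "real (d - 1) > 1" using d by linarith
    ultimately have "norm l = 0"
      using mult_le_cancel_right[of "real (d - 1)" "norm l" 1] by auto
    moreover have "norm k \<le> norm l"
      using spectral_radius_mem_max(2)[OF M n0] l(2) k by (auto simp: spectrum_def)
    ultimately show "k = 0" by simp
  qed
  \<comment> \<open>The exact nilpotency index. It is at least 2 because \<open>M\<close> is
    nonzero, so \<open>q = p - 1\<close> is positive and the power \<open>q\<close> of
    \<open>M\<close> is the last nonzero one.\<close>
  define p where "p = (LEAST p. M ^\<^sub>m p = 0\<^sub>m n n)"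
  have Mp: "M ^\<^sub>m p = 0\<^sub>m n n"
    unfolding p_def using nilpotent_if_eigenvalues_zero[OF M eigen] by (rule LeastI_ex)
  have M0: "M \<noteq> 0\<^sub>m n n"
  proof
    assume M: "M = 0\<^sub>m n n"
    have "a i j = 0" if "i \<in> ?I" "j \<in> ?I" for i j
    proof -
      have "a i j = M $$ (i - 1, j - 1)" using that by (cases i; cases j) (auto simp: M_def)
      also have "\<dots> = 0" using that unfolding M by (cases i; cases j) auto
      finally show ?thesis .
    qed
    then show False using La[OF nz(1)] nz by simp
  qed
  have "p \<noteq> 0"
  proof
    assume "p = 0"
    then have eq: "1\<^sub>m n = (0\<^sub>m n n :: complex mat)" using Mp M by simp
    have "(1\<^sub>m n :: complex mat) $$ (0, 0) = 0" unfolding eq using n0 by simp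
    then show False using n0 by simp
  qed
  moreover have "p \<noteq> 1" using Mp M M0 by auto
  ultimately obtain q where q: "p = Suc q" "q \<ge> 1" by (cases p) auto
  have "q < p" using q(1) by simp
  then have Mq: "M ^\<^sub>m q \<noteq> 0\<^sub>m n n" unfolding p_def by (rule not_less_Least)
  have "\<exists>r<n. \<exists>c<n. (M ^\<^sub>m q) $$ (r, c) \<noteq> 0"
  proof (rule ccontr)
    assume "\<not> ?thesis"
    then have "M ^\<^sub>m q = 0\<^sub>m n n"
      using pow_carrier_mat[OF M, of q] by (intro eq_matI) auto
    then show False using Mq by blast
  qed
  then obtain r c where rc: "r < n" "c < n" "(M ^\<^sub>m q) $$ (r, c) \<noteq> 0" by blast
  have Mk0: "M ^\<^sub>m k = 0\<^sub>m n n" if "k > q" for k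
    using that
  proof (induction k)
    case (Suc k)
    then show ?case using Mp q(1) M by (cases "k = q") (auto simp: pow_mat_Suc_left[OF M])
  qed simp
  \<comment> \<open>The curve exp(tM) applied to the basis vector number \<open>c\<close>, where
    column \<open>c\<close> of the \<open>q\<close>-th power is nonzero. By nilpotency the series is
    a polynomial of degree at most \<open>q\<close>.\<close>
  define y where "y i = (\<Sum>k\<le>q. Polynomial.monom ((M ^\<^sub>m k) $$ (i - 1, c) / fact k) k)" for i
  have coeff_y: "Polynomial.coeff (y i) k = (M ^\<^sub>m k) $$ (i - 1, c) / fact k" if "i \<in> ?I" for i k
    using that rc(2) Mk0[of k]
    by (auto simp: y_def coeff_sum not_le)
  have deg_y: "Polynomial.degree (y i) \<le> q" for i
    unfolding y_def by (intro degree_sum_le) (auto intro: order.trans[OF degree_monom_le])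
  have M_Suc: "(M ^\<^sub>m Suc k) $$ (r, s) = (\<Sum>t<n. a (Suc r) (Suc t) * (M ^\<^sub>m k) $$ (t, s))"
    if "r < n" "s < n" for r s k
    unfolding pow_mat_Suc_left[OF M] using that M pow_carrier_mat[OF M, of k]
    by (auto simp: scalar_prod_def M_def lessThan_atLeast0)
  \<comment> \<open>The curve is an integral curve of the linear vector field
    \<open>L\<close>.\<close>
  have pderiv_y: "pderiv (y i) = pp.ev y (L i)" if i: "i \<in> ?I" for i
  proof (rule poly_eqI)
    fix k
    have "Polynomial.coeff (pderiv (y i)) k = (M ^\<^sub>m Suc k) $$ (i - 1, c) / fact k"
      using i of_nat_neq_0[of k, where 'a = complex]
      by (simp add: coeff_pderiv coeff_y del: pow_mat.simps)
    also have "\<dots> = (\<Sum>t<n. a i (Suc t) * ((M ^\<^sub>m k) $$ (t, c) / fact k))"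
      using i rc(2) by (subst M_Suc) (auto simp: sum_divide_distrib)
    also have "\<dots> = Polynomial.coeff (\<Sum>j\<in>?I. [:a i j:] * y j) k"
      unfolding sum_shift coeff_sum by (intro sum.cong) (auto simp: coeff_y)
    also have "(\<Sum>j\<in>?I. [:a i j:] * y j) = pp.ev y (L i)"
      unfolding La[OF i] by (simp add: pp.ev_sum pp.ev_mult)
    finally show "Polynomial.coeff (pderiv (y i)) k = Polynomial.coeff (pp.ev y (L i)) k" .
  qed
  define G where "G j = pp.ev y (partial j g)" for j
  \<comment> \<open>The chain rule along the curve and \<open>key\<close>: the gradient satisfies
    the linear equation with matrix minus the transpose of \<open>M\<close>.\<close>
  have pderiv_G: "pderiv (G j) = - (\<Sum>i\<in>?I. smult (a i j) (G i))" if j: "j \<in> ?I" for j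
  proof -
    have "pderiv (G j) = (\<Sum>i\<in>?I. pp.ev y (partial i (partial j g)) * pderiv (y i))"
      unfolding G_def using forms_vars[OF gj]
      by (intro pp.ev_chain_rule) (auto simp: pderiv_add pderiv_mult pderiv_pCons algebra_simps)
    also have "\<dots> = pp.ev y (\<Sum>i\<in>?I. L i * partial i (partial j g))"
      by (simp add: pp.ev_sum pp.ev_mult pderiv_y mult.commute)
    also have "\<dots> = - (\<Sum>i\<in>?I. smult (a i j) (G i))"
      unfolding key[OF j] by (simp add: pp.ev_sum pp.ev_mult pp.ev_uminus G_def)
    finally show ?thesis .
  qed
  \<comment> \<open>Summation runs over the row index, so this is the \<open>k\<close>-th power of
    minus the transpose; for \<open>k = p\<close> it vanishes.\<close>
  have iter: "(pderiv ^^ k) (G (Suc s)) = (\<Sum>r<n. smult ((-1) ^ k * (M ^\<^sub>m k) $$ (r, s)) (G (Suc r)))"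
    if s: "s < n" for s k
  proof (induction k)
    case 0
    have "(\<Sum>r<n. smult ((-1) ^ 0 * (M ^\<^sub>m 0) $$ (r, s)) (G (Suc r))) =
        (\<Sum>r<n. if r = s then G (Suc r) else 0)"
      using s M by (intro sum.cong) auto
    then show ?case using s by (simp add: sum.delta)
  next
    case (Suc k)
    have "(pderiv ^^ Suc k) (G (Suc s)) =
        (\<Sum>r<n. smult ((-1) ^ k * (M ^\<^sub>m k) $$ (r, s)) (pderiv (G (Suc r))))"
      by (simp add: Suc pderiv_sum pderiv_smult)
    also have "\<dots> = (\<Sum>r<n. \<Sum>t<n.
        smult ((-1) ^ Suc k * (a (Suc t) (Suc r) * (M ^\<^sub>m k) $$ (r, s))) (G (Suc t)))"
      by (intro sum.cong refl, subst pderiv_G, force, unfold sum_shift)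
        (auto simp: smult_sum2 sum_negf mult_ac)
    also have "\<dots> = (\<Sum>t<n. \<Sum>r<n.
        smult ((-1) ^ Suc k * (a (Suc t) (Suc r) * (M ^\<^sub>m k) $$ (r, s))) (G (Suc t)))"
      by (rule sum.swap)
    also have "\<dots> = (\<Sum>t<n. smult ((-1) ^ Suc k * (M ^\<^sub>m Suc k) $$ (t, s)) (G (Suc t)))"
      using s by (intro sum.cong refl, subst M_Suc) (auto simp: smult_sum sum_distrib_left)
    finally show ?case .
  qed
  \<comment> \<open>The leading direction of the curve: column \<open>c\<close> of the
    \<open>q\<close>-th power of \<open>M\<close>, divided by \<open>fact q\<close>.\<close>
  define u where "u i = Polynomial.coeff (y i) q" for i
  have "\<exists>i\<in>?I. u i \<noteq> 0"
    using rc by (intro bexI[of _ "Suc r"]) (auto simp: u_def coeff_y)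
  then obtain j where j: "j \<in> ?I" "poly_eval (partial j g) u \<noteq> 0" using smooth by blast
  have "(pderiv ^^ p) (G j) = 0"
    using iter[of "j - 1" p] j(1) by (auto simp: Mp)
  \<comment> \<open>\<open>p = q + 1\<close> is at most \<open>2 * q\<close>, hence at most
    \<open>q * (d - 1)\<close>. A polynomial whose \<open>p\<close>-th derivative vanishes has no
    terms of such degree.\<close>
  moreover have "p \<le> q * (d - 1)"
  proof -
    have "q * (d - 1) \<ge> q * 2" using d by (intro mult_le_mono) auto
    then show ?thesis using q by linarith
  qed
  then obtain t where t: "q * (d - 1) = t + p" using le_Suc_ex by (metis add.commute)
  \<comment> \<open>The factor by which \<open>p\<close> differentiations multiply the coefficient
    in degree \<open>t + p\<close>; it is nonzero in characteristic 0.\<close>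
  have "pochhammer (of_nat (Suc t)) p \<noteq> (0 :: complex)"
    unfolding pochhammer_of_nat of_nat_eq_0_iff using pochhammer_pos[of "Suc t" p] by linarith
  ultimately have "Polynomial.coeff (G j) (q * (d - 1)) = 0"
    using coeff_higher_pderiv[of p "G j" t] unfolding t by simp
  then show False
    using coeff_eval_form[OF gj, of y q j] deg_y j(2) unfolding G_def u_def by simp
qed

section \<open>From zeros of the gradient to projective singular points\<close>

lemma poly_eval_scale:
  assumes "h \<in> forms I k"
  shows "poly_eval h (\<lambda>i. c * u i) = c ^ k * poly_eval h u"
  unfolding poly_eval_def sum_distrib_left
proof (rule sum.cong[OF refl])
  fix m assume "m \<in> Poly_Mapping.keys h"
  then have "k = (\<Sum>i\<in>Poly_Mapping.keys m. Poly_Mapping.lookup m i)"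
    using assms by (auto simp: forms_iff mon_degree_def)
  then show "Poly_Mapping.lookup h m * (\<Prod>i\<in>Poly_Mapping.keys m. (c * u i) ^ Poly_Mapping.lookup m i) =
      c ^ k * (Poly_Mapping.lookup h m * (\<Prod>i\<in>Poly_Mapping.keys m. u i ^ Poly_Mapping.lookup m i))"
    by (simp add: power_mult_distrib prod.distrib power_sum)
qed

text \<open>Euler's identity makes \<open>g\<close> vanish at \<open>u\<close> too, since
  \<open>d > 0\<close>; homogeneity spreads the vanishing to all scalar multiples. Cutting
  \<open>u\<close> off outside \<open>I\<close> meets the encoding of projective points.\<close>

lemma sing_locus_nonempty:
  assumes g: "g \<in> forms I d" and "d > 0" "finite I"
    and u: "\<exists>i\<in>I. u i \<noteq> 0" "\<forall>i\<in>I. poly_eval (partial i g) u = 0"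
  shows "sing_locus I g \<noteq> {}"
proof -
  let ?u = "restrict u I"
  have van: "vanishes_at h (proj_point I ?u)" if "h \<in> forms I k" "poly_eval h u = 0" for h k
    unfolding vanishes_at_def proj_point_def
  proof clarify
    fix c :: complex
    have "poly_eval h (\<lambda>i\<in>I. c * ?u i) = poly_eval h (\<lambda>i. c * u i)"
      by (rule pe.ev_cong[OF forms_vars[OF that(1)]]) auto
    then show "poly_eval h (\<lambda>i\<in>I. c * ?u i) = 0"
      using poly_eval_scale[OF that(1)] that(2) by simp
  qed
  have "of_nat d * poly_eval g u = (\<Sum>i\<in>I. u i * poly_eval (partial i g) u)"
    using arg_cong[OF euler_identity[OF g \<open>finite I\<close>], of "\<lambda>p. poly_eval p u"]
    unfolding single_of_nat[symmetric] Const_def[symmetric]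
    by (simp add: pe.ev_sum pe.ev_mult)
  then have "poly_eval g u = 0" using u(2) \<open>d > 0\<close> by simp
  moreover have "proj_point I ?u \<in> proj_space I"
    unfolding proj_space_def using u(1) by (intro imageI) auto
  ultimately have "proj_point I ?u \<in> sing_locus I g"
    unfolding sing_locus_def using van[OF g] van[OF partial_forms[OF g]] u(2) by blast
  then show ?thesis by blast
qed

lemma smooth_no_linear_syzygy:
  assumes "g \<in> forms {1..n} d" "d \<ge> 3" "smooth_hypersurface {1..n} g"
    and "\<And>i. i \<in> {1..n} \<Longrightarrow> L i \<in> forms {1..n} 1"
    and "(\<Sum>i\<in>{1..n}. L i * partial i g) = 0" "i \<in> {1..n}"
  shows "L i = 0"
proof (rule ccontr)
  assume "L i \<noteq> 0"
  then obtain u where "\<exists>i\<in>{1..n}. u i \<noteq> 0" "\<forall>i\<in>{1..n}. poly_eval (partial i g) u = 0"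
    using linear_syzygy_imp_singular[OF assms(1,2,4,5,6)] by blast
  then show False
    using sing_locus_nonempty[OF assms(1)] assms(2,3) by (auto simp: smooth_hypersurface_def)
qed

section \<open>Constant syzygies and cones\<close>

text \<open>Distinct monomials containing variable \<open>k\<close> have distinct derivatives, so
  nothing cancels, and the exponent factor is nonzero in characteristic 0.\<close>

lemma not_in_vars_if_partial_eq_0:
  assumes "partial k p = 0" shows "k \<notin> vars p"
proof
  assume "k \<in> vars p"
  then obtain m where m: "m \<in> Poly_Mapping.keys p" "Poly_Mapping.lookup m k \<noteq> 0"
    by (auto simp: vars_def in_keys_iff)
  let ?e = "Poly_Mapping.single k (1::nat)"
  have "Poly_Mapping.lookup (partial k p) (m - ?e) =
      (\<Sum>m'\<in>Poly_Mapping.keys p. if m' = m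
         then of_nat (Poly_Mapping.lookup m k) * Poly_Mapping.lookup p m else 0)"
    unfolding partial_def lookup_sum
  proof (rule sum.cong[OF refl])
    fix m' assume "m' \<in> Poly_Mapping.keys p"
    show "Poly_Mapping.lookup (Poly_Mapping.single (m' - ?e)
          (of_nat (Poly_Mapping.lookup m' k) * Poly_Mapping.lookup p m')) (m - ?e) =
        (if m' = m then of_nat (Poly_Mapping.lookup m k) * Poly_Mapping.lookup p m else 0)"
    proof (cases "m' - ?e = m - ?e \<and> Poly_Mapping.lookup m' k \<noteq> 0")
      case True
      then have "m' = m" using mon_split[of m' k] mon_split[OF m(2)] by metis
      then show ?thesis by simp
    next
      case False
      then show ?thesis using m(2) by (auto simp: lookup_single when_def)
    qed
  qed
  also have "\<dots> = of_nat (Poly_Mapping.lookup m k) * Poly_Mapping.lookup p m"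
    using m(1) by simp
  finally show False using assms m by (simp add: in_keys_iff)
qed

text \<open>As a coordinate change this makes \<open>b\<close> the direction of coordinate
  \<open>k\<close>: differentiating in variable \<open>k\<close> afterwards is differentiating along
  \<open>b\<close> before.\<close>

definition column_mat :: "nat \<Rightarrow> nat \<Rightarrow> (nat \<Rightarrow> 'a) \<Rightarrow> 'a :: field mat" where
  "column_mat N k b = mat N N (\<lambda>(i, j). if j = k then b i else if i = j then 1 else 0)"

text \<open>The hypothesis says that column \<open>k\<close> of the product is the basis vector
  number \<open>k\<close>; the other columns are right automatically.\<close>

lemma column_mat_mult_eq_one:
  assumes "k < N"
    and "\<And>i. i < N \<Longrightarrow> b i * b' k + (if i = k then 0 else b' i) = (if i = k then 1 else 0)"
  shows "column_mat N k b * column_mat N k b' = 1\<^sub>m N"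
proof (rule eq_matI)
  fix i j assume "i < dim_row (1\<^sub>m N)" "j < dim_col (1\<^sub>m N)"
  then have ij: "i < N" "j < N" by auto
  let ?B = "\<lambda>l. if j = k then b' l else if l = j then 1 else 0"
  have "(column_mat N k b * column_mat N k b') $$ (i, j) =
      (\<Sum>l<N. (if l = k then b i else if i = l then 1 else 0) * ?B l)"
    using ij by (simp add: column_mat_def scalar_prod_def lessThan_atLeast0)
  also have "\<dots> = (\<Sum>l<N. (if l = k then b i * ?B k else 0) +
      (if l = i then if i = k then 0 else ?B i else 0))"
    by (intro sum.cong) auto
  also have "\<dots> = b i * ?B k + (if i = k then 0 else ?B i)"
    unfolding sum.distrib using ij assms(1) by (subst (1 2) sum.delta) auto
  also have "\<dots> = 1\<^sub>m N $$ (i, j)"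
    using ij assms(2)[OF ij(1)] by auto
  finally show "(column_mat N k b * column_mat N k b') $$ (i, j) = 1\<^sub>m N $$ (i, j)" .
qed (auto simp: column_mat_def)

lemma invertible_column_mat:
  assumes "k < N" "b k \<noteq> 0"
  shows "invertible_mat (column_mat N k b)"
proof -
  let ?b = "\<lambda>i. if i = k then 1 / b k else - b i / b k"
  have "column_mat N k b * column_mat N k ?b = 1\<^sub>m N"
    using assms by (intro column_mat_mult_eq_one) (auto simp: field_simps)
  moreover have "column_mat N k ?b * column_mat N k b = 1\<^sub>m N"
    using assms by (intro column_mat_mult_eq_one) (auto simp: field_simps)
  ultimately show ?thesis
    unfolding invertible_mat_def inverts_mat_def
    by (intro conjI exI[of _ "column_mat N k ?b"]) (auto simp: column_mat_def)
qed

text \<open>A constant relation is a vanishing directional derivative along \<open>c\<close>. If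
  \<open>c k\<close> were nonzero, \<open>c\<close> could be made coordinate direction
  \<open>k\<close>, and the transformed \<open>f\<close> would be free of variable \<open>k\<close>,
  so a cone.\<close>

lemma no_constant_syzygy:
  assumes f: "f \<in> forms {0..n} d" and "\<not> is_cone n f"
    and syz: "(\<Sum>i\<in>{0..n}. Const (c i) * partial i f) = 0" and k: "k \<le> n"
  shows "c k = 0"
proof (rule ccontr)
  assume ck: "c k \<noteq> 0"
  let ?A = "column_mat (n + 1) k c"
  let ?\<sigma> = "\<lambda>i. \<Sum>j\<le>n. Const (?A $$ (i, j)) * Var j"
  have "partial k (?\<sigma> i) = Const (c i)" if "i \<in> {0..n}" for i
  proof -
    have "partial k (?\<sigma> i) = (\<Sum>j\<le>n. if j = k then Const (?A $$ (i, j)) else 0)"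
      unfolding partial_sum by (intro sum.cong) (auto simp: partial_mult partial_Var)
    also have "\<dots> = Const (c i)" using that k by (simp add: column_mat_def)
    finally show ?thesis .
  qed
  moreover have "partial k (poly_subst ?\<sigma> f) =
      (\<Sum>i\<in>{0..n}. poly_subst ?\<sigma> (partial i f) * partial k (?\<sigma> i))"
    by (rule ps.ev_chain_rule) (use forms_vars[OF f] in \<open>auto simp: partial_add partial_mult\<close>)
  ultimately have "partial k (poly_subst ?\<sigma> f) =
      poly_subst ?\<sigma> (\<Sum>i\<in>{0..n}. Const (c i) * partial i f)"
    by (simp add: ps.ev_sum ps.ev_mult mult.commute)
  then have "k \<notin> vars (linear_change n ?A f)"
    unfolding linear_change_def syz by (intro not_in_vars_if_partial_eq_0) simp
  moreover have "invertible_mat ?A" using k ck by (intro invertible_column_mat) auto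
  moreover have "?A \<in> carrier_mat (n + 1) (n + 1)" by (simp add: column_mat_def)
  ultimately show False using assms(2) k by (auto simp: is_cone_def)
qed

section \<open>Initial degree and graded pieces of the syzygy module\<close>

lemma indeg_eq_1_iff: "indeg z N = 1 \<longleftrightarrow> N 0 = {z} \<and> N 1 \<noteq> {z}"
proof
  assume *: "indeg z N = 1"
  have "N 0 = {z}"
  proof (rule ccontr)
    assume "N 0 \<noteq> {z}"
    then have "indeg z N \<le> enat 0" unfolding indeg_def by (intro INF_lower) simp
    then show False using * by (simp add: zero_enat_def[symmetric])
  qed
  moreover have "N 1 \<noteq> {z}"
  proof
    assume "N 1 = {z}"
    have "enat 2 \<le> indeg z N" unfolding indeg_def
    proof (rule INF_greatest)
      fix k assume "k \<in> {k. N k \<noteq> {z}}"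
      then have "k \<noteq> 0" "k \<noteq> 1" using \<open>N 0 = {z}\<close> \<open>N 1 = {z}\<close> by (metis mem_Collect_eq)+
      then show "enat 2 \<le> enat k" by simp
    qed
    then show False using * by (simp add: one_enat_def)
  qed
  ultimately show "N 0 = {z} \<and> N 1 \<noteq> {z}" ..
next
  assume *: "N 0 = {z} \<and> N 1 \<noteq> {z}"
  have "indeg z N \<le> enat 1" unfolding indeg_def using * by (intro INF_lower) simp
  moreover have "enat 1 \<le> indeg z N" unfolding indeg_def
  proof (rule INF_greatest)
    fix k assume "k \<in> {k. N k \<noteq> {z}}"
    then have "k \<noteq> 0" using * by (metis mem_Collect_eq)
    then show "enat 1 \<le> enat k" by simp
  qed
  ultimately show "indeg z N = 1" by (simp add: one_enat_def)
qed

text \<open>Syzygies are stored as extensional functions; this passes to arbitrary families, whose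
  values outside \<open>I\<close> are irrelevant.\<close>

lemma syz_component_eq_zero_iff:
  "syz_component I g k = {\<lambda>i\<in>I. 0} \<longleftrightarrow>
    (\<forall>L. (\<forall>i\<in>I. L i \<in> forms I k) \<and> (\<Sum>i\<in>I. L i * partial i g) = 0 \<longrightarrow> (\<forall>i\<in>I. L i = 0))"
  (is "?l \<longleftrightarrow> ?r")
proof
  assume l: ?l
  show ?r
  proof (intro allI impI ballI)
    fix L i assume L: "(\<forall>i\<in>I. L i \<in> forms I k) \<and> (\<Sum>i\<in>I. L i * partial i g) = 0" and i: "i \<in> I"
    then have "restrict L I \<in> syz_component I g k"
      using forms_vars by (auto simp: syz_component_def syz_def carrier_poly_ring)
    then have "restrict L I = (\<lambda>i\<in>I. 0)" using l by blast
    then show "L i = 0" using i by (metis restrict_apply')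
  qed
next
  assume r: ?r
  have "(\<lambda>i\<in>I. 0) \<in> syz_component I g k"
    by (auto simp: syz_component_def syz_def carrier_poly_ring)
  moreover have "L = (\<lambda>i\<in>I. 0)" if "L \<in> syz_component I g k" for L
  proof -
    have "L \<in> extensional I" using that by (auto simp: syz_component_def syz_def PiE_def)
    moreover have "\<forall>i\<in>I. L i = 0" using that r by (auto simp: syz_component_def syz_def)
    ultimately show ?thesis by (auto simp: extensional_def)
  qed
  ultimately show ?l by blast
qed

section \<open>The map \<open>\<psi>\<close>\<close>

text \<open>By linearity injectivity is triviality of the kernel, and vectors correspond to linear
  forms. The product is already a form of degree \<open>d\<close>, so membership in the degree
  \<open>d\<close> piece of the ideal is membership in the ideal.\<close>

lemma inj_on_psi_iff:
  assumes f: "f \<in> forms {0..n} d" and "d \<ge> 1"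
  shows "inj_on (psi n d f) (carrier_vec n) \<longleftrightarrow>
    (\<forall>l\<in>forms {1..n} 1. l * restrict0 (partial 0 f) \<in> jac_ideal {1..n} (restrict0 f) \<longrightarrow> l = 0)"
    (is "?inj \<longleftrightarrow> ?ker")
proof -
  let ?R = "poly_ring {1..n}"
  interpret cring ?R by (rule cring_poly_ring)
  let ?J = "jac_ideal {1..n} (restrict0 f)"
  let ?W = "?J \<inter> forms {1..n} d"
  let ?l = "\<lambda>b. \<Sum>i=1..n. Const (b $ (i - 1)) * Var i"
  let ?h = "restrict0 (partial 0 f)"
  interpret J: ideal ?J ?R
    by (rule jac_ideal_is_ideal[OF forms_vars[OF restrict0_forms[OF f]]])
  have W_diff: "p - q \<in> ?W" if "p \<in> ?W" "q \<in> ?W" for p q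
  proof -
    have "vars q \<subseteq> {1..n}" using that forms_vars by blast
    then have "- q \<in> ?J" using J.a_inv_closed[of q] that poly_ring_a_inv by simp
    then have "p - q \<in> ?J" using J.a_closed[of p "- q"] that by simp
    then show ?thesis using that forms_diff by blast
  qed
  have W0: "0 \<in> ?W" using J.zero_closed by simp
  have W_add: "p + q \<in> ?W" if "p \<in> ?W" "q \<in> ?W" for p q
    using W_diff[OF that(1) W_diff[OF W0 that(2)]] by simp
  have psi: "psi n d f b = {w + ?l b * ?h | w. w \<in> ?W}" for b
    unfolding psi_def a_r_coset_def' by auto
  have l_forms: "?l b \<in> forms {1..n} 1" for b
    by (intro forms_sum Const_mult_forms Var_forms)
  have h: "?h \<in> forms {1..n} (d - 1)" by (intro restrict0_forms partial_forms f)
  have lh: "l * ?h \<in> forms {1..n} d" if "l \<in> forms {1..n} 1" for l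
    using forms_mult[OF that h] \<open>d \<ge> 1\<close> by simp
  have psi_eq: "psi n d f b = psi n d f b' \<longleftrightarrow> (?l b - ?l b') * ?h \<in> ?J" for b b'
  proof
    assume eq: "psi n d f b = psi n d f b'"
    have "?l b * ?h \<in> psi n d f b" unfolding psi using W0 by (auto intro!: exI[of _ 0])
    then obtain w where "w \<in> ?W" "?l b * ?h = w + ?l b' * ?h" unfolding eq psi[of b'] by blast
    then show "(?l b - ?l b') * ?h \<in> ?J" by (simp add: left_diff_distrib)
  next
    assume "(?l b - ?l b') * ?h \<in> ?J"
    then have D: "(?l b - ?l b') * ?h \<in> ?W"
      using lh[OF forms_diff[OF l_forms l_forms]] by blast
    show "psi n d f b = psi n d f b'"
    proof (intro equalityI subsetI)
      fix p assume "p \<in> psi n d f b"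
      then obtain w where w: "w \<in> ?W" "p = w + ?l b * ?h" unfolding psi by blast
      have "p = (w + (?l b - ?l b') * ?h) + ?l b' * ?h" by (simp add: w(2) left_diff_distrib)
      then show "p \<in> psi n d f b'" unfolding psi using W_add[OF w(1) D] by blast
    next
      fix p assume "p \<in> psi n d f b'"
      then obtain w where w: "w \<in> ?W" "p = w + ?l b' * ?h" unfolding psi by blast
      have "p = (w - (?l b - ?l b') * ?h) + ?l b * ?h" by (simp add: w(2) left_diff_distrib)
      then show "p \<in> psi n d f b" unfolding psi using W_diff[OF w(1) D] by blast
    qed
  qed
  have l_coeff: "b $ i = Poly_Mapping.lookup (?l b) (Poly_Mapping.single (Suc i) 1)" if "i < n" for b i
    using lookup_linear_form[of "{1..n}" "Suc i" "\<lambda>i. b $ (i - 1)"] that by simp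
  show ?thesis
  proof
    assume inj: ?inj
    show ?ker
    proof (intro ballI impI)
      fix l assume l: "l \<in> forms {1..n} 1" "l * ?h \<in> ?J"
      define b where "b = vec n (\<lambda>i. Poly_Mapping.lookup l (Poly_Mapping.single (Suc i) 1))"
      have lb: "?l b = l"
      proof -
        have "?l b = (\<Sum>i\<in>{1..n}. Const (Poly_Mapping.lookup l (Poly_Mapping.single i 1)) * Var i)"
          by (intro sum.cong) (auto simp: b_def)
        then show ?thesis using forms_1_expand[OF l(1)] by simp
      qed
      have l0: "?l (0\<^sub>v n) = 0" by (intro sum.neutral) auto
      have "psi n d f b = psi n d f (0\<^sub>v n)" unfolding psi_eq lb l0 using l(2) by simp
      then have "b = 0\<^sub>v n" using inj by (auto simp: inj_on_def b_def)
      then show "l = 0" using lb l0 by simp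
    qed
  next
    assume ker: ?ker
    show ?inj
    proof (rule inj_onI)
      fix b b' assume b: "b \<in> carrier_vec n" "b' \<in> carrier_vec n" "psi n d f b = psi n d f b'"
      then have "?l b - ?l b' = 0"
        using ker forms_diff[OF l_forms l_forms] unfolding psi_eq by blast
      then have "?l b = ?l b'" by simp
      then show "b = b'"
        using b(1,2) by (intro eq_vecI) (simp_all only: l_coeff carrier_vecD)
    qed
  qed
qed

section \<open>Linear relations modulo variable 0\<close>

lemma sum_atLeast0_split: "(\<Sum>i\<in>{0..n}. F i) = F 0 + (\<Sum>i\<in>{1..n}. F i)"
  for F :: "nat \<Rightarrow> 'a :: comm_monoid_add"
  by (simp add: sum.atLeast_Suc_atMost)

lemma Var_mult_cancel:
  assumes "Var i * p = Var i * q" shows "p = q"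
proof (rule poly_mapping_eqI)
  have *: "Poly_Mapping.lookup (Var i * p) (Poly_Mapping.single i 1 + m) = Poly_Mapping.lookup p m" for p m
    by (induction p rule: cpoly_single_induct)
      (auto simp: Var_def mult_single lookup_single when_def distrib_left lookup_add)
  fix m show "Poly_Mapping.lookup p m = Poly_Mapping.lookup q m"
    using *[of p m] *[of q m] assms by simp
qed

text \<open>Common core of both cases of the converse. On the hyperplane, injectivity of
  \<open>psi\<close> kills the coefficient of index 0 and smoothness kills the others. So each
  \<open>L i\<close> is a constant times variable 0, which can then be cancelled.\<close>

lemma linear_relation_mod_hyperplane:
  assumes "d \<ge> 3" and f: "f \<in> forms {0..n} d"
    and smooth: "smooth_hypersurface {1..n} (restrict0 f)"
    and inj: "inj_on (psi n d f) (carrier_vec n)"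
    and L: "\<And>i. i \<in> {0..n} \<Longrightarrow> L i \<in> forms {0..n} 1"
    and rel: "(\<Sum>i\<in>{0..n}. L i * partial i f) = Var 0 * h"
  obtains c where "\<And>i. i \<in> {0..n} \<Longrightarrow> L i = Var 0 * Const (c i)"
    "h = (\<Sum>i\<in>{0..n}. Const (c i) * partial i f)"
proof -
  let ?g = "restrict0 f"
  have g: "?g \<in> forms {1..n} d" by (rule restrict0_forms[OF f])
  have L': "restrict0 (L i) \<in> forms {1..n} 1" if "i \<in> {0..n}" for i
    using L[OF that] by (rule restrict0_forms)
  have "restrict0 (\<Sum>i\<in>{0..n}. L i * partial i f) = 0"
    unfolding rel restrict0_mult restrict0_Var by simp
  then have 0: "restrict0 (L 0) * restrict0 (partial 0 f) +
      (\<Sum>i\<in>{1..n}. restrict0 (L i) * partial i ?g) = 0"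
    unfolding sum_atLeast0_split restrict0_add restrict0_mult restrict0_sum
    using partial_restrict0[OF forms_vars[OF f]] by simp
  then have "restrict0 (L 0) * restrict0 (partial 0 f) =
      (\<Sum>i\<in>{1..n}. (- restrict0 (L i)) * partial i ?g)"
    by (simp add: sum_negf eq_neg_iff_add_eq_0)
  moreover have "vars (- restrict0 (L i)) \<subseteq> {1..n}" if "i \<in> {1..n}" for i
    using forms_vars[OF L'[of i]] that by (simp add: vars_uminus)
  ultimately have "restrict0 (L 0) * restrict0 (partial 0 f) \<in> jac_ideal {1..n} ?g"
    unfolding jac_ideal_eq[OF finite_atLeastAtMost forms_vars[OF g]] mem_Collect_eq
    by (intro exI[of _ "\<lambda>i. - restrict0 (L i)"]) simp
  moreover have "1 \<le> d" using \<open>d \<ge> 3\<close> by simp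
  ultimately have L0: "restrict0 (L 0) = 0"
    using inj L'[of 0] unfolding inj_on_psi_iff[OF f \<open>1 \<le> d\<close>] by simp
  have "restrict0 (L i) = 0" if "i \<in> {0..n}" for i
  proof (cases "i = 0")
    case False
    show ?thesis
    proof (rule smooth_no_linear_syzygy[OF g \<open>d \<ge> 3\<close> smooth])
      show "(\<Sum>i\<in>{1..n}. restrict0 (L i) * partial i ?g) = 0" using 0 L0 by simp
      show "restrict0 (L j) \<in> forms {1..n} 1" if "j \<in> {1..n}" for j
        using L'[of j] that by simp
    qed (use that False in auto)
  qed (use L0 in simp)
  have "\<exists>c. L i = Var 0 * Const c" if i: "i \<in> {0..n}" for i
  proof -
    have "L i \<in> forms {0..n} (Suc 0)" using L[OF i] by simp
    then obtain q where "q \<in> forms {0..n} 0" "L i = Var 0 * q"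
      using \<open>\<And>i. i \<in> {0..n} \<Longrightarrow> restrict0 (L i) = 0\<close>[OF i] by (rule restrict0_eq_0)
    then show ?thesis by (auto simp: forms_0_iff)
  qed
  then obtain c where c: "\<And>i. i \<in> {0..n} \<Longrightarrow> L i = Var 0 * Const (c i)" by metis
  have "Var 0 * h = Var 0 * (\<Sum>i\<in>{0..n}. Const (c i) * partial i f)"
    unfolding rel[symmetric] sum_distrib_left by (intro sum.cong) (simp_all add: c mult.assoc)
  then have "h = (\<Sum>i\<in>{0..n}. Const (c i) * partial i f)" by (rule Var_mult_cancel)
  with c show ?thesis by (rule that)
qed

theorem proposition3p1:
  fixes n d :: nat and f :: cpoly
  assumes "n \<ge> 2" and "d \<ge> 3"
    and "f \<in> forms {0..n} d" and "f \<noteq> 0"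
    and "isolated_singularities {0..n} f"
    and "\<not> is_cone n f"
    and "smooth_hypersurface {1..n} (restrict0 f)"
  shows "\<not> inj_on (psi n d f) (carrier_vec n) \<longleftrightarrow>
     indeg_syz {0..n} f = 1 \<or>
     \<not> inj_on (milnor_mult {0..n} f (Var 0)) (milnor_component {0..n} f (d - 1))"
proof -
  let ?I = "{0..n}" and ?R = "{1..n}"
  note f = assms(3) and d = assms(2)
  note fin = finite_atLeastAtMost[of 0 n]
  obtain e where e: "d = Suc e" using d by (cases d) auto
  have fe: "f \<in> forms ?I (Suc e)" using f e by simp
  have pf: "partial i f \<in> forms ?I e" for i using partial_forms[OF fe] by simp
  have V0: "Var 0 \<in> forms ?I 1" by (rule Var_forms) simp
  have const: "c k = 0" if "(\<Sum>i\<in>?I. Const (c i) * partial i f) = 0" "k \<in> ?I" for c k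
    using no_constant_syzygy[OF f assms(6) that(1)] that(2) by simp
  have syz0: "syz_component ?I f 0 = {\<lambda>i\<in>?I. 0}"
    unfolding syz_component_eq_zero_iff
  proof (intro allI impI ballI)
    fix L i assume L: "(\<forall>i\<in>?I. L i \<in> forms ?I 0) \<and> (\<Sum>i\<in>?I. L i * partial i f) = 0" and i: "i \<in> ?I"
    then obtain c where c: "\<And>i. i \<in> ?I \<Longrightarrow> L i = Const (c i)" unfolding forms_0_iff by metis
    then have "(\<Sum>i\<in>?I. Const (c i) * partial i f) = 0" using L by simp
    then show "L i = 0" using const i c by simp
  qed
  have indeg: "indeg_syz ?I f = 1 \<longleftrightarrow>
     (\<exists>L. (\<forall>i\<in>?I. L i \<in> forms ?I 1) \<and> (\<Sum>i\<in>?I. L i * partial i f) = 0 \<and> (\<exists>i\<in>?I. L i \<noteq> 0))"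
    unfolding indeg_syz_def indeg_eq_1_iff syz0 syz_component_eq_zero_iff by blast
  have milnor: "inj_on (milnor_mult ?I f (Var 0)) (milnor_component ?I f (d - 1)) \<longleftrightarrow>
     (\<forall>h\<in>forms ?I e. Var 0 * h \<in> jac_ideal ?I f \<longrightarrow> h \<in> jac_ideal ?I f)"
    using inj_on_milnor_mult_iff[OF forms_vars[OF f] forms_vars[OF V0]] e by simp
  have psi: "inj_on (psi n d f) (carrier_vec n) \<longleftrightarrow>
    (\<forall>l\<in>forms ?R 1. l * restrict0 (partial 0 f) \<in> jac_ideal ?R (restrict0 f) \<longrightarrow> l = 0)"
    using inj_on_psi_iff[OF f] d by simp
  note jac_forms = jac_ideal_forms_iff[OF fin fe]
  show ?thesis
  proof
    assume "\<not> inj_on (psi n d f) (carrier_vec n)"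
    then obtain l where l: "l \<in> forms ?R 1" "l \<noteq> 0"
      "l * restrict0 (partial 0 f) \<in> jac_ideal ?R (restrict0 f)"
      unfolding psi by blast
    have "l * restrict0 (partial 0 f) \<in> forms ?R (1 + e)"
      by (intro forms_mult l(1) restrict0_forms pf)
    then obtain q where q: "\<And>i. i \<in> ?R \<Longrightarrow> q i \<in> forms ?R 1"
      and lq: "l * restrict0 (partial 0 f) = (\<Sum>i\<in>?R. q i * partial i (restrict0 f))"
      using l(3) jac_ideal_forms_iff[OF finite_atLeastAtMost restrict0_forms[OF fe]] by blast
    \<comment> \<open>Lifts the relation on the hyperplane to all variables; the error
      \<open>H\<close> vanishes on the hyperplane and is therefore divisible by variable 0.\<close>
    define L where "L i = (if i = 0 then l else - q i)" for i
    have RI: "forms ?R 1 \<subseteq> forms ?I 1" by (rule forms_mono) auto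
    have L: "L i \<in> forms ?I 1" if "i \<in> ?I" for i
      using that l(1) q[of i] RI by (auto simp: L_def intro!: forms_uminus)
    define H where "H = (\<Sum>i\<in>?I. L i * partial i f)"
    have H: "H \<in> forms ?I (Suc e)"
      unfolding H_def using forms_mult[OF L pf] by (intro forms_sum) simp
    have "restrict0 H = restrict0 l * restrict0 (partial 0 f) -
        (\<Sum>i\<in>?R. restrict0 (q i) * restrict0 (partial i f))"
      unfolding H_def sum_atLeast0_split by (simp add: L_def restrict0_add restrict0_mult
          restrict0_sum sum_negf restrict0_diff)
    also have "\<dots> = l * restrict0 (partial 0 f) - (\<Sum>i\<in>?R. q i * partial i (restrict0 f))"
      using restrict0_id[OF l(1)] restrict0_id[OF q] partial_restrict0[OF forms_vars[OF f]]
      by (intro arg_cong2[of _ _ _ _ minus] sum.cong refl) auto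
    also have "\<dots> = 0" using lq by simp
    finally obtain h where h: "h \<in> forms ?I e" "H = Var 0 * h"
      using restrict0_eq_0[OF H] by blast
    have "H \<in> forms ?I (1 + e)" using H by simp
    from jac_forms[OF this] have H_jac: "Var 0 * h \<in> jac_ideal ?I f"
      unfolding h(2)[symmetric] using L H_def by blast
    show "indeg_syz ?I f = 1 \<or>
        \<not> inj_on (milnor_mult ?I f (Var 0)) (milnor_component ?I f (d - 1))"
    \<comment> \<open>If \<open>h\<close> lies in the ideal, the error can be absorbed into the
      coefficients and a linear syzygy results; otherwise the class of \<open>h\<close> is a nonzero
      element killed by variable 0.\<close>
    proof (cases "h \<in> jac_ideal ?I f")
      case True
      have "h \<in> forms ?I (0 + e)" using h(1) by simp
      with True obtain a where a: "\<And>i. i \<in> ?I \<Longrightarrow> a i \<in> forms ?I 0"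
        "h = (\<Sum>i\<in>?I. a i * partial i f)"
        using jac_forms by blast
      let ?L = "\<lambda>i. L i - Var 0 * a i"
      have "?L i \<in> forms ?I 1" if "i \<in> ?I" for i
        using forms_diff[OF L[OF that]] forms_mult[OF V0 a(1)[OF that]] by simp
      moreover have "(\<Sum>i\<in>?I. ?L i * partial i f) = H - Var 0 * h"
        by (simp add: H_def a(2) left_diff_distrib sum_subtractf sum_distrib_left mult.assoc)
      \<comment> \<open>The correction is a multiple of variable 0, so on the hyperplane this
        coefficient is still \<open>l\<close>.\<close>
      moreover have "?L 0 \<noteq> 0"
      proof
        assume "?L 0 = 0"
        then have "restrict0 (?L 0) = 0" by simp
        then show False
          using l(2) restrict0_id[OF l(1)]
          by (simp add: restrict0_diff restrict0_mult restrict0_Var L_def)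
      qed
      ultimately have "indeg_syz ?I f = 1"
        unfolding indeg using h(2) by (intro exI[of _ ?L] conjI bexI[of _ 0]) auto
      then show ?thesis ..
    next
      case False
      then show ?thesis unfolding milnor using h(1) H_jac by blast
    qed
  next
    assume cond: "indeg_syz ?I f = 1 \<or>
        \<not> inj_on (milnor_mult ?I f (Var 0)) (milnor_component ?I f (d - 1))"
    show "\<not> inj_on (psi n d f) (carrier_vec n)"
    proof
      assume inj: "inj_on (psi n d f) (carrier_vec n)"
      note relation = linear_relation_mod_hyperplane[OF d f assms(7) inj]
      from cond show False
      proof
        assume "indeg_syz ?I f = 1"
        then obtain L i where L: "\<And>i. i \<in> ?I \<Longrightarrow> L i \<in> forms ?I 1"
          "(\<Sum>i\<in>?I. L i * partial i f) = 0" and i: "i \<in> ?I" "L i \<noteq> 0"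
          unfolding indeg by blast
        \<comment> \<open>A syzygy is the case \<open>h = 0\<close>: the constants obtained form a
          constant relation, so they vanish, and with them all \<open>L i\<close>.\<close>
        have "(\<Sum>i\<in>?I. L i * partial i f) = Var 0 * 0" using L(2) by simp
        from relation[OF L(1) this] obtain c where
          c: "\<And>i. i \<in> ?I \<Longrightarrow> L i = Var 0 * Const (c i)"
            "0 = (\<Sum>i\<in>?I. Const (c i) * partial i f)" by metis
        then show False using const[OF c(2)[symmetric] i(1)] i c(1) by simp
      next
        assume "\<not> inj_on (milnor_mult ?I f (Var 0)) (milnor_component ?I f (d - 1))"
        then obtain h where h: "h \<in> forms ?I e" "Var 0 * h \<in> jac_ideal ?I f" "h \<notin> jac_ideal ?I f"
          unfolding milnor by blast
        have "Var 0 * h \<in> forms ?I (1 + e)" by (rule forms_mult[OF V0 h(1)])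
        then obtain L where L: "\<And>i. i \<in> ?I \<Longrightarrow> L i \<in> forms ?I 1"
          "Var 0 * h = (\<Sum>i\<in>?I. L i * partial i f)"
          using h(2) jac_forms by blast
        \<comment> \<open>Here \<open>h\<close> represents a nonzero kernel class, but it turns out
          to be a constant combination of the partial derivatives.\<close>
        from relation[OF L(1) L(2)[symmetric]] obtain c where
          "h = (\<Sum>i\<in>?I. Const (c i) * partial i f)" by metis
        moreover have "h \<in> forms ?I (0 + e)" using h(1) by simp
        ultimately have "h \<in> jac_ideal ?I f"
          unfolding jac_forms[OF \<open>h \<in> forms ?I (0 + e)\<close>]
          by (intro exI[of _ "\<lambda>i. Const (c i)"]) simp
        then show False using h(3) by blast
      qed
    qed
  qed
qed

end
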